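(* Let $0<\alpha<2$, $p\in[1,\infty]$ and $j,N\in\mathbb{N}$ (with $\mathbb{N}=\{0,1,2,\dots\}$). Let $u_0\in L^1((1+|x|)^{N+1}dx)$. Then there is a constant $c$ such that for all $t\geq 1$, $$\Big\|S_\alpha(t)\ast u_0-\sum_{n=0}^N\frac{(-1)^n}{n!}\mathcal{M}_n(u_0)\partial_x^nG_\alpha(t)-\sum_{k=1}^N\frac{t^k}{k!}\sum_{\ell=0}^{N-1}\frac{(-1)^\ell}{\ell !}\mathcal{M}_\ell(u_0)\partial_x^\ell(-\partial_x)^{3k}G_\alpha(t)\Big\|_{\dot{H}^{p,j}}\leq ct^{-(1-1/p)/\alpha-j/\alpha-(N+1)/\alpha},$$ where for $N=0$ the sum $\sum_{k=1}^N$ is understood to be $0$.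
   Context: For $t>0$, $x\in\mathbb{R}$, $S_\alpha(t,x)=\frac{1}{2\pi}\int_{-\infty}^\infty e^{ix\xi}e^{(i\xi^3-|\xi|^\alpha)t}d\xi$ and $G_\alpha(t,x)=\frac{1}{2\pi}\int_{-\infty}^\infty e^{ix\xi}e^{-t|\xi|^\alpha}d\xi$ (the fundamental solution of $u_t+|D|^\alpha u=0$, where $\widehat{|D|^\alpha\varphi}(\xi)=|\xi|^\alpha\widehat\varphi(\xi)$). For $f\in L^1(x^jdx)$, $\mathcal{M}_j(f)=\int_{-\infty}^\infty f(x)x^jdx$. For $p\in[1,\infty]$ and $j\geq 0$, $\|f\|_{\dot{H}^{p,j}}=\|\partial_x^jf\|_{L^p}$, norms taken in the $x$-variable. Convolution is in $x$. *)

theory Defs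
  imports "HOL-Analysis.Analysis" "HOL-Probability.Essential_Supremum"
begin

definition S_kernel :: "real \<Rightarrow> real \<Rightarrow> real \<Rightarrow> complex" where
  "S_kernel \<alpha> t x = complex_of_real (1 / (2 * pi)) *
     (LINT \<xi>|lborel. exp (\<i> * complex_of_real (x * \<xi>)) *
        exp ((\<i> * complex_of_real (\<xi> ^ 3) - complex_of_real (\<bar>\<xi>\<bar> powr \<alpha>)) * complex_of_real t))"

definition G_kernel :: "real \<Rightarrow> real \<Rightarrow> real \<Rightarrow> complex" where
  "G_kernel \<alpha> t x = complex_of_real (1 / (2 * pi)) *
     (LINT \<xi>|lborel. exp (\<i> * complex_of_real (x * \<xi>)) *
        exp (- complex_of_real (t * \<bar>\<xi>\<bar> powr \<alpha>)))"

definition moment :: "nat \<Rightarrow> (real \<Rightarrow> real) \<Rightarrow> real" where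
  "moment j f = (LINT x|lborel. f x * x ^ j)"

definition conv :: "(real \<Rightarrow> complex) \<Rightarrow> (real \<Rightarrow> real) \<Rightarrow> real \<Rightarrow> complex" where
  "conv k f x = (LINT y|lborel. k (x - y) * complex_of_real (f y))"

definition dx :: "(real \<Rightarrow> complex) \<Rightarrow> real \<Rightarrow> complex" where
  "dx f x = vector_derivative f (at x)"

definition neg_dx :: "(real \<Rightarrow> complex) \<Rightarrow> real \<Rightarrow> complex" where
  "neg_dx f x = - dx f x"

definition Lp_norm :: "ereal \<Rightarrow> (real \<Rightarrow> complex) \<Rightarrow> ennreal" where
  "Lp_norm p f =
     (if p = \<infinity> then esssup lborel (\<lambda>x. ennreal (norm (f x)))
      else (let I = (\<integral>\<^sup>+ x. ennreal (norm (f x) powr real_of_ereal p) \<partial>lborel) in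
            if I = \<infinity> then \<infinity> else ennreal (enn2real I powr (1 / real_of_ereal p))))"

definition Hdot_norm :: "ereal \<Rightarrow> nat \<Rightarrow> (real \<Rightarrow> complex) \<Rightarrow> ennreal" where
  "Hdot_norm p j f = Lp_norm p ((dx ^^ j) f)"

definition inv_exp :: "ereal \<Rightarrow> real" where
  "inv_exp p = (if p = \<infinity> then 0 else 1 / real_of_ereal p)"

end

theory Submission
  imports Defs "HOL-Probability.Sinc_Integral"
begin

text \<open>
  Write \<open>K(s,m)\<close> for the inverse Fourier transform of \<open>(i\<xi>)^m exp(is\<xi>^3 - t|\<xi>|^\<alpha>)\<close>, so that
  \<open>S = K(t,0)\<close>, \<open>G = K(0,0)\<close>, \<open>\<partial>\<^sub>x K(s,m) = K(s,m+1)\<close> and \<open>\<partial>\<^sub>s K(s,m) = - K(s,m+3)\<close>. The approximation is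
  then a Taylor expansion of \<open>K(t,j)(x-y)\<close> about \<open>s = 0\<close> and \<open>y = 0\<close>, and every remainder involves only
  kernels with \<open>m \<ge> 1\<close>. For these the second derivative of the symbol is integrable (it is at worst
  \<open>|\<xi>|^(\<alpha>-1)\<close> near \<open>0\<close>), so after rescaling to \<open>t = 1\<close> the kernel is \<open>O(1/(1+x^2))\<close> uniformly for
  \<open>0 \<le> s \<le> 1\<close>. This gives the \<open>L^1\<close> and \<open>L^\<infinity>\<close> bounds of the remainders, and \<open>L^p\<close> follows by
  interpolation. Each power of \<open>t\<close> from the expansion in \<open>s\<close> is compensated because \<open>t^(1-3/\<alpha>) \<le> t^(-1/\<alpha>)\<close> for
  \<open>t \<ge> 1\<close> and \<open>\<alpha> < 2\<close>.
\<close>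

section \<open>Differentiation, Taylor remainders and interpolation\<close>

text \<open>The obstacle is m = 0: there the second derivative of the symbol is of size
  |\<xi>|^(\<alpha>-2) at the origin, and for \<alpha> < 1 the kernel has tails of size
  |x|^(-1-\<alpha>), too heavy for a bound by 1/(1+x^2). Only remainders are estimated, and each has
  been differentiated at least once, so this case never occurs, not even for j = 0. The expansion in
  s is made at the point x - y, and its coefficients are then expanded in y. The coefficient with
  index k \<ge> 1 comes with t^k and 3k derivatives, which already gains t^(-1/\<alpha>); N further
  orders in y are enough for it, while k = 0 needs N + 1. This is why the inner sum of the statement
  ends at N - 1. The remainders in y grow like a power of |y| of exponent at most N + 1, which is
  the weight imposed on the datum. Scaling makes the sup rate better than the L^1 rate by exactly
  t^(-1/\<alpha>), and interpolating between the two produces the term (1-1/p)/\<alpha> of the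
  exponent.\<close>

text \<open>The mean value inequality turns \<open>bound\<close> into a Lipschitz bound with the
  same \<open>g\<close>. The normalised error \<open>?q\<close> of the linear approximation is
  therefore dominated by 2 * g, and dominated convergence along sequences applies.\<close>

lemma integral_has_vector_derivative_dominated:
  fixes f f' :: "real \<Rightarrow> 'a \<Rightarrow> 'b::euclidean_space"
  assumes int: "\<And>x. integrable M (f x)"
    and deriv: "\<And>x y. ((\<lambda>x. f x y) has_vector_derivative f' x y) (at x)"
    and bound: "\<And>x y. norm (f' x y) \<le> g y"
    and g: "integrable M g"
    and meas: "\<And>x. f' x \<in> borel_measurable M"
  shows "((\<lambda>x. integral\<^sup>L M (f x)) has_vector_derivative integral\<^sup>L M (f' x)) (at x)"
proof -
  have "norm (f' x y) \<le> norm (g y)" for y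
    using bound[of x y] by simp
  then have int': "integrable M (f' x)"
    by (intro Bochner_Integration.integrable_bound[OF g meas] AE_I2)
  let ?q = "\<lambda>z y. (f z y - f x y - (z - x) *\<^sub>R f' x y) /\<^sub>R norm (z - x)"
  have lip: "norm (f z y - f x y) \<le> g y * norm (z - x)" for z y
  proof -
    have der: "((\<lambda>x. f x y) has_derivative (\<lambda>h. h *\<^sub>R f' u y)) (at u within UNIV)" for u
      using deriv[of y u] by (simp add: has_vector_derivative_def)
    have "onorm (\<lambda>h. h *\<^sub>R f' u y) \<le> g y" for u
    proof (rule onorm_le)
      show "norm (h *\<^sub>R f' u y) \<le> g y * norm h" for h :: real
        using mult_right_mono[OF bound[of u y] abs_ge_zero[of h]] by (simp add: mult.commute)
    qed
    then show ?thesis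
      using differentiable_bound[OF convex_UNIV der] by blast
  qed
  have qbound: "norm (?q z y) \<le> 2 * g y" if "z \<noteq> x" for z y
  proof -
    have "norm (f z y - f x y - (z - x) *\<^sub>R f' x y) \<le> norm (f z y - f x y) + norm ((z - x) *\<^sub>R f' x y)"
      by (rule norm_triangle_ineq4)
    also have "\<dots> \<le> g y * norm (z - x) + norm (z - x) * g y"
      using lip[of z y] bound[of x y] by (intro add_mono) (auto intro: mult_left_mono)
    finally have "norm (f z y - f x y - (z - x) *\<^sub>R f' x y) / norm (z - x) \<le> 2 * g y"
      using that by (subst pos_divide_le_eq) (auto simp: mult.commute mult.left_commute)
    then show ?thesis
      by (simp only: norm_scaleR abs_inverse abs_norm_cancel divide_inverse mult.commute)
  qed
  have qlim: "((\<lambda>z. ?q z y) \<longlongrightarrow> 0) (at x)" for y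
    using deriv[of y x] by (simp add: has_vector_derivative_def has_derivative_at_within)
  have qint: "integral\<^sup>L M (?q z) =
      (integral\<^sup>L M (f z) - integral\<^sup>L M (f x) - (z - x) *\<^sub>R integral\<^sup>L M (f' x)) /\<^sub>R norm (z - x)" for z
    using int int' by (simp add: Bochner_Integration.integral_diff)
  have "((\<lambda>z. integral\<^sup>L M (?q z)) \<longlongrightarrow> 0) (at x)"
    unfolding tendsto_at_iff_sequentially comp_def
  proof (intro allI impI)
    fix X :: "nat \<Rightarrow> real"
    assume X: "\<forall>i. X i \<in> UNIV - {x}" "X \<longlonglongrightarrow> x"
    have "(\<lambda>n. integral\<^sup>L M (?q (X n))) \<longlonglongrightarrow> integral\<^sup>L M (\<lambda>y. 0)"
    proof (rule integral_dominated_convergence)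
      show "integrable M (\<lambda>y. 2 * g y)" using g by simp
      show "AE y in M. (\<lambda>n. ?q (X n) y) \<longlonglongrightarrow> 0"
        using qlim X by (auto simp: tendsto_at_iff_sequentially comp_def)
      show "AE y in M. norm (?q (X n) y) \<le> 2 * g y" for n
        using qbound X by auto
      show "?q (X n) \<in> borel_measurable M" for n
        using borel_measurable_integrable[OF int] meas by measurable
    qed simp
    then show "(\<lambda>n. integral\<^sup>L M (?q (X n))) \<longlonglongrightarrow> 0" by simp
  qed
  then have "((\<lambda>z. (integral\<^sup>L M (f z) - integral\<^sup>L M (f x) - (z - x) *\<^sub>R integral\<^sup>L M (f' x)) /\<^sub>R norm (z - x)) \<longlongrightarrow> 0) (at x)"
    by (simp only: qint)
  then show ?thesis
    by (simp add: has_vector_derivative_def has_derivative_at_within bounded_linear_scaleR_left)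
qed

text \<open>Integral form of the remainder, whose weight (1-\<theta>)^(p-1)/(p-1)! is at most 1 on
  [0,1] and is dropped. Leaving the bound as an integral over \<theta> serves two purposes: a
  pointwise bound on \<open>h p\<close> gives a sup estimate, and Tonelli gives an L^1
  estimate.\<close>

lemma norm_taylor_remainder_le_nn_integral:
  fixes h :: "nat \<Rightarrow> real \<Rightarrow> 'a::euclidean_space"
  assumes deriv: "\<And>i t. (h i has_vector_derivative h (Suc i) t) (at t)"
    and p: "0 < p"
  shows "ennreal (norm (h 0 1 - (\<Sum>i<p. h i 0 /\<^sub>R fact i)))
    \<le> (\<integral>\<^sup>+\<theta>. indicator {0..1} \<theta> * ennreal (norm (h p \<theta>)) \<partial>lborel)"
proof -
  let ?g = "\<lambda>x. ((1 - x) ^ (p - 1) / fact (p - 1)) *\<^sub>R h p x"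
  have "(?g has_integral (h 0 1 - (\<Sum>i<p. ((1 - 0) ^ i / fact i) *\<^sub>R h i 0))) {0..1}"
    by (rule Taylor_has_integral[OF p refl])
      (use deriv in \<open>auto intro: has_vector_derivative_at_within\<close>)
  then have I: "(?g has_integral (h 0 1 - (\<Sum>i<p. h i 0 /\<^sub>R fact i))) {0..1}"
    by (simp add: divide_inverse)
  have cont: "continuous_on UNIV (h p)"
    using deriv by (auto intro!: continuous_at_imp_continuous_on has_vector_derivative_continuous)
  then have cont1: "continuous_on {0..1} (h p)"
    by (rule continuous_on_subset) simp
  have si: "set_integrable lborel {0..1} ?g"
    by (rule borel_integrable_atLeastAtMost') (intro continuous_intros cont1, simp)
  have eq: "h 0 1 - (\<Sum>i<p. h i 0 /\<^sub>R fact i) = (LINT x:{0..1}|lborel. ?g x)"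
    by (subst set_borel_integral_eq_integral(2)[OF si]) (rule integral_unique[OF I, symmetric])
  have "ennreal (norm (LINT x:{0..1}|lborel. ?g x)) \<le> (\<integral>\<^sup>+x. ennreal (norm (indicator {0..1} x *\<^sub>R ?g x)) \<partial>lborel)"
    unfolding set_lebesgue_integral_def
    using si[unfolded set_integrable_def] by (rule integral_norm_bound_ennreal)
  also have "\<dots> \<le> (\<integral>\<^sup>+\<theta>. indicator {0..1} \<theta> * ennreal (norm (h p \<theta>)) \<partial>lborel)"
  proof (rule nn_integral_mono)
    fix x :: real
    have "(1 - x) ^ (p - 1) / fact (p - 1) * norm (h p x) \<le> norm (h p x)" if "x \<in> {0..1}"
    proof (rule mult_left_le_one_le)
      have "(1 - x) ^ (p - 1) \<le> 1"
        using that by (intro power_le_one) auto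
      then show "(1 - x) ^ (p - 1) / fact (p - 1) \<le> 1"
        using fact_ge_1[of "p - 1", where 'a=real] by (simp add: divide_le_eq del: fact_ge_1)
    qed (use that in auto)
    then show "ennreal (norm (indicator {0..1} x *\<^sub>R ?g x)) \<le> indicator {0..1} x * ennreal (norm (h p x))"
      by (auto simp: indicator_def intro!: ennreal_leI)
  qed
  finally show ?thesis by (simp add: eq)
qed

lemma norm_taylor_remainder_le:
  fixes h :: "nat \<Rightarrow> real \<Rightarrow> 'a::euclidean_space"
  assumes deriv: "\<And>i t. (h i has_vector_derivative h (Suc i) t) (at t)"
    and p: "0 < p"
    and bound: "\<And>\<theta>. \<theta> \<in> {0..1} \<Longrightarrow> norm (h p \<theta>) \<le> B"
  shows "norm (h 0 1 - (\<Sum>i<p. h i 0 /\<^sub>R fact i)) \<le> B"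
proof -
  have B: "0 \<le> B" using bound[of 0] by (auto intro: order_trans[OF norm_ge_zero])
  have "ennreal (norm (h 0 1 - (\<Sum>i<p. h i 0 /\<^sub>R fact i)))
    \<le> (\<integral>\<^sup>+\<theta>. indicator {0..1} \<theta> * ennreal (norm (h p \<theta>)) \<partial>lborel)"
    using deriv p by (rule norm_taylor_remainder_le_nn_integral)
  also have "\<dots> \<le> (\<integral>\<^sup>+\<theta>. ennreal B * indicator {0..1::real} \<theta> \<partial>lborel)"
    using bound by (intro nn_integral_mono) (auto simp: indicator_def intro!: ennreal_leI)
  also have "\<dots> = ennreal B"
    by (subst nn_integral_cmult_indicator) auto
  finally show ?thesis using B by simp
qed

text \<open>Here every x carries its own curve \<theta> \<mapsto> \<open>h x i \<theta>\<close>.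
  Tonelli moves the integral over x inside, where \<theta> is fixed and \<open>bound\<close>
  applies; the remaining integral over [0,1] costs nothing.\<close>

lemma nn_integral_taylor_remainder_le:
  fixes h :: "real \<Rightarrow> nat \<Rightarrow> real \<Rightarrow> 'a::euclidean_space"
  assumes deriv: "\<And>x i t. (h x i has_vector_derivative h x (Suc i) t) (at t)"
    and p: "0 < p"
    and meas: "(\<lambda>(x, \<theta>). h x p \<theta>) \<in> borel_measurable (lborel \<Otimes>\<^sub>M lborel)"
    and bound: "\<And>\<theta>. \<theta> \<in> {0..1} \<Longrightarrow> (\<integral>\<^sup>+x. ennreal (norm (h x p \<theta>)) \<partial>lborel) \<le> B"
  shows "(\<integral>\<^sup>+x. ennreal (norm (h x 0 1 - (\<Sum>i<p. h x i 0 /\<^sub>R fact i))) \<partial>lborel) \<le> B"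
proof -
  have [measurable]: "(\<lambda>z. h (fst z) p (snd z)) \<in> borel_measurable (lborel \<Otimes>\<^sub>M lborel)"
    using meas by (simp add: case_prod_beta')
  have "(\<integral>\<^sup>+x. ennreal (norm (h x 0 1 - (\<Sum>i<p. h x i 0 /\<^sub>R fact i))) \<partial>lborel)
    \<le> (\<integral>\<^sup>+x. (\<integral>\<^sup>+\<theta>. indicator {0..1} \<theta> * ennreal (norm (h x p \<theta>)) \<partial>lborel) \<partial>lborel)"
    by (intro nn_integral_mono norm_taylor_remainder_le_nn_integral deriv p)
  also have "\<dots> = (\<integral>\<^sup>+\<theta>. (\<integral>\<^sup>+x. indicator {0..1} \<theta> * ennreal (norm (h x p \<theta>)) \<partial>lborel) \<partial>lborel)"
    by (rule lborel_pair.Fubini'[symmetric]) (simp add: case_prod_beta')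
  also have "\<dots> \<le> (\<integral>\<^sup>+\<theta>. B * indicator {0..1::real} \<theta> \<partial>lborel)"
    using bound by (intro nn_integral_mono) (auto simp: indicator_def)
  also have "\<dots> = B"
    by (subst nn_integral_cmult_indicator) auto
  finally show ?thesis .
qed

text \<open>For finite p = r this is |f|^r \<le> A^(r-1) |f|, integrated. Positivity of A and B
  keeps \<open>powr\<close> well behaved: in particular B powr 0 is 1 at p = \<infinity>, whereas
  \<open>0 powr 0\<close> would be 0.\<close>

lemma Lp_norm_le_interpolation:
  assumes p: "1 \<le> p"
    and f: "f \<in> borel_measurable lborel"
    and A: "0 < A" "\<And>x. norm (f x) \<le> A"
    and B: "0 < B" "(\<integral>\<^sup>+x. ennreal (norm (f x)) \<partial>lborel) \<le> ennreal B"
  shows "Lp_norm p f \<le> ennreal (A powr (1 - inv_exp p) * B powr inv_exp p)"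
proof (cases "p = \<infinity>")
  case True
  then have "Lp_norm p f = esssup lborel (\<lambda>x. ennreal (norm (f x)))"
    by (simp add: Lp_norm_def)
  also have "\<dots> \<le> ennreal A"
    using f A by (intro esssup_I) (auto intro!: ennreal_leI)
  finally show ?thesis using True A B by (simp add: inv_exp_def)
next
  case False
  with p obtain r where r: "p = ereal r" "1 \<le> r"
    by (cases p) (auto simp: one_ereal_def)
  define I where "I = (\<integral>\<^sup>+x. ennreal (norm (f x) powr r) \<partial>lborel)"
  have pw: "norm (f x) powr r \<le> A powr (r - 1) * norm (f x)" for x
  proof (cases "norm (f x) = 0")
    case False
    then have "norm (f x) powr r = norm (f x) powr (r - 1) * norm (f x)"
      by (simp add: powr_diff)
    also have "\<dots> \<le> A powr (r - 1) * norm (f x)"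
      using A r by (intro mult_right_mono powr_mono2) auto
    finally show ?thesis .
  qed simp
  have "I \<le> (\<integral>\<^sup>+x. ennreal (A powr (r - 1)) * ennreal (norm (f x)) \<partial>lborel)"
    unfolding I_def using pw by (intro nn_integral_mono) (auto simp: ennreal_mult[symmetric] intro!: ennreal_leI)
  also have "\<dots> = ennreal (A powr (r - 1)) * (\<integral>\<^sup>+x. ennreal (norm (f x)) \<partial>lborel)"
    using f by (intro nn_integral_cmult) auto
  also have "\<dots> \<le> ennreal (A powr (r - 1)) * ennreal B"
    using B by (intro mult_left_mono) auto
  also have "\<dots> = ennreal (A powr (r - 1) * B)"
    using B by (simp add: ennreal_mult)
  finally have I: "I \<le> ennreal (A powr (r - 1) * B)" .
  then have fin: "I \<noteq> \<infinity>" by (auto simp: top_unique)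
  have "enn2real I \<le> A powr (r - 1) * B"
    using I B by (intro enn2real_leI) auto
  then have "enn2real I powr (1 / r) \<le> (A powr (r - 1) * B) powr (1 / r)"
    using r by (intro powr_mono2) auto
  also have "\<dots> = A powr (1 - 1 / r) * B powr (1 / r)"
    using A B r by (simp add: powr_mult powr_powr field_simps)
  finally show ?thesis
    using fin False r by (simp add: Lp_norm_def I_def[symmetric] Let_def inv_exp_def ennreal_leI)
qed

section \<open>Integrability of the symbols\<close>

lemma power_div_fact_le_exp:
  fixes x :: real
  assumes "0 \<le> x"
  shows "x ^ k / fact k \<le> exp x"
proof -
  have "(\<Sum>n\<in>{k}. x ^ n /\<^sub>R fact n) \<le> (\<Sum>n. x ^ n /\<^sub>R fact n)"
    using assms by (intro sum_le_suminf summable_exp_generic) auto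
  then show ?thesis by (simp add: exp_def divide_inverse mult.commute)
qed

lemma integrable_inverse_1_plus_square_lborel:
  "integrable lborel (\<lambda>x::real. inverse (1 + x\<^sup>2))"
  using integrable_inverse_1_plus_square by (simp add: set_integrable_def)

lemma nn_integral_inverse_1_plus_square:
  "(\<integral>\<^sup>+x. ennreal (inverse (1 + x\<^sup>2)) \<partial>lborel) = ennreal pi"
proof -
  have "(LINT x|lborel. inverse (1 + x\<^sup>2)) = pi"
    using LBINT_inverse_1_plus_square
    by (simp add: interval_lebesgue_integral_def set_lebesgue_integral_def)
  then show ?thesis
    by (subst nn_integral_eq_integral[OF integrable_inverse_1_plus_square_lborel])
      (auto simp: add_nonneg_nonneg)
qed

text \<open>A single term (t \<xi>^\<alpha>)^k / k! of the exponential series suffices once \<alpha>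
  k \<ge> b + 2. The factor 2 in the constant comes from 1 + \<xi>^2 \<le> 2 \<xi>^2 for \<xi> \<ge>
  1.\<close>

lemma powr_mult_exp_le_inverse_square:
  fixes \<alpha> t b :: real
  assumes "0 < \<alpha>" "0 < t"
  obtains C where "0 \<le> C"
    "\<And>\<xi>. 1 \<le> \<xi> \<Longrightarrow> \<xi> powr b * exp (- (t * \<xi> powr \<alpha>)) \<le> C * inverse (1 + \<xi>\<^sup>2)"
proof -
  obtain k :: nat where "(b + 2) / \<alpha> \<le> k"
    using real_arch_simple by blast
  then have k: "b + 2 \<le> \<alpha> * k"
    using assms by (simp add: field_simps)
  show ?thesis
  proof (rule that)
    show "0 \<le> 2 * fact k / t ^ k"
      using assms by simp
    fix \<xi> :: real assume \<xi>: "1 \<le> \<xi>"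
    have "\<xi> powr b * \<xi>\<^sup>2 = \<xi> powr (b + 2)"
      using \<xi> by (simp add: powr_add powr_numeral)
    also have "\<dots> \<le> \<xi> powr (\<alpha> * k)"
      using k \<xi> by (intro powr_mono) auto
    also have "\<dots> = (\<xi> powr \<alpha>) ^ k"
      using \<xi> by (simp add: powr_powr[symmetric] powr_realpow)
    finally have "\<xi> powr b * \<xi>\<^sup>2 * t ^ k / fact k \<le> (\<xi> powr \<alpha>) ^ k * t ^ k / fact k"
      using assms by (intro divide_right_mono mult_right_mono) auto
    also have "\<dots> = (t * \<xi> powr \<alpha>) ^ k / fact k"
      by (simp add: power_mult_distrib mult.commute)
    also have "\<dots> \<le> exp (t * \<xi> powr \<alpha>)"
      using assms by (intro power_div_fact_le_exp) auto
    finally have 1: "\<xi> powr b * \<xi>\<^sup>2 * t ^ k \<le> fact k * exp (t * \<xi> powr \<alpha>)"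
      by (simp add: field_simps)
    have "\<xi> powr b * (1 + \<xi>\<^sup>2) * t ^ k \<le> \<xi> powr b * (2 * \<xi>\<^sup>2) * t ^ k"
      using \<xi> assms by (intro mult_right_mono mult_left_mono) auto
    also have "\<dots> \<le> 2 * fact k * exp (t * \<xi> powr \<alpha>)"
      using 1 by simp
    finally show "\<xi> powr b * exp (- (t * \<xi> powr \<alpha>)) \<le> 2 * fact k / t ^ k * inverse (1 + \<xi>\<^sup>2)"
      using assms by (simp add: exp_minus field_simps add_pos_nonneg)
  qed
qed

lemma powr_mult_exp_tendsto_0:
  fixes \<alpha> t b :: real
  assumes "0 < \<alpha>" "0 < t"
  shows "((\<lambda>\<xi>. \<xi> powr b * exp (- (t * \<xi> powr \<alpha>))) \<longlongrightarrow> 0) at_top"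
proof -
  obtain C where C: "0 \<le> C"
    "\<And>\<xi>. 1 \<le> \<xi> \<Longrightarrow> \<xi> powr b * exp (- (t * \<xi> powr \<alpha>)) \<le> C * inverse (1 + \<xi>\<^sup>2)"
    using powr_mult_exp_le_inverse_square[OF assms] by metis
  have sq: "filterlim (\<lambda>\<xi>::real. 1 + \<xi>\<^sup>2) at_top at_top"
    by (intro filterlim_tendsto_add_at_top[OF tendsto_const] filterlim_pow_at_top filterlim_ident) auto
  have lim: "((\<lambda>\<xi>. C * inverse (1 + \<xi>\<^sup>2)) \<longlongrightarrow> C * 0) at_top"
    by (intro tendsto_intros tendsto_inverse_0_at_top sq)
  show ?thesis
  proof (rule tendsto_sandwich[OF _ _ tendsto_const])
    show "((\<lambda>\<xi>. C * inverse (1 + \<xi>\<^sup>2)) \<longlongrightarrow> 0) at_top" using lim by simp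
    show "\<forall>\<^sub>F \<xi> in at_top. \<xi> powr b * exp (- (t * \<xi> powr \<alpha>)) \<le> C * inverse (1 + \<xi>\<^sup>2)"
      using C(2) by (auto intro: eventually_at_top_linorderI)
  qed auto
qed

lemma integrable_powr_mult_exp:
  fixes \<alpha> t b :: real
  assumes "0 < \<alpha>" "0 < t" "-1 < b"
  shows "integrable lborel (\<lambda>\<xi>. indicator {0<..} \<xi> * (\<xi> powr b * exp (- (t * \<xi> powr \<alpha>))))"
proof -
  obtain C where C: "0 \<le> C"
    "\<And>\<xi>. 1 \<le> \<xi> \<Longrightarrow> \<xi> powr b * exp (- (t * \<xi> powr \<alpha>)) \<le> C * inverse (1 + \<xi>\<^sup>2)"
    using powr_mult_exp_le_inverse_square[OF assms(1,2)] by metis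
  have "(\<lambda>x. x powr b) absolutely_integrable_on {0<..1}"
    using assms by (intro nonnegative_absolutely_integrable_1 integrable_on_powr_from_0') auto
  \<comment> \<open>Absolute integrability refers to the completed measure; Borel measurability
    brings it back to \<open>lborel\<close>.\<close>
  then have I: "integrable lborel (\<lambda>x. indicator {0<..1} x * x powr b)"
    unfolding set_integrable_def by (subst (asm) integrable_completion) auto
  show ?thesis
  proof (rule Bochner_Integration.integrable_bound)
    show "integrable lborel (\<lambda>\<xi>. indicator {0<..1} \<xi> * \<xi> powr b + C * inverse (1 + \<xi>\<^sup>2))"
      using I integrable_inverse_1_plus_square_lborel
      by (intro Bochner_Integration.integrable_add integrable_mult_right) auto
    have "\<bar>indicator {0<..} \<xi> * (\<xi> powr b * exp (- (t * \<xi> powr \<alpha>)))\<bar>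
      \<le> \<bar>indicator {0<..1} \<xi> * \<xi> powr b + C * inverse (1 + \<xi>\<^sup>2)\<bar>" for \<xi>
    proof -
      have nn: "0 \<le> C * inverse (1 + \<xi>\<^sup>2)" using C by (auto intro!: mult_nonneg_nonneg add_nonneg_nonneg)
      consider "\<xi> \<le> 0" | "0 < \<xi>" "\<xi> \<le> 1" | "1 < \<xi>" by linarith
      then show ?thesis
      proof cases
        case 1 then show ?thesis by simp
      next
        case 2
        have "\<xi> powr b * exp (- (t * \<xi> powr \<alpha>)) \<le> \<xi> powr b * 1"
          using assms by (intro mult_left_mono) auto
        then have "\<xi> powr b * exp (- (t * \<xi> powr \<alpha>)) \<le> \<xi> powr b + C * inverse (1 + \<xi>\<^sup>2)"
          using nn by linarith
        then show ?thesis using 2 nn by simp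
      next
        case 3
        then show ?thesis using C(2)[of \<xi>] nn by simp
      qed
    qed
    then show "AE \<xi> in lborel. norm (indicator {0<..} \<xi> * (\<xi> powr b * exp (- (t * \<xi> powr \<alpha>))))
      \<le> norm (indicator {0<..1} \<xi> * \<xi> powr b + C * inverse (1 + \<xi>\<^sup>2))" by simp
  qed auto
qed

lemma integrable_abs_power_mult_exp:
  fixes \<alpha> t :: real
  assumes "0 < \<alpha>" "0 < t"
  shows "integrable lborel (\<lambda>\<xi>. \<bar>\<xi>\<bar> ^ m * exp (- (t * \<bar>\<xi>\<bar> powr \<alpha>)))"
proof -
  let ?f = "\<lambda>\<xi>. indicator {0<..} \<xi> * (\<xi> powr m * exp (- (t * \<xi> powr \<alpha>)))"
  have I: "integrable lborel ?f"
    using assms by (intro integrable_powr_mult_exp) auto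
  \<comment> \<open>The even function is the half-line function plus its reflection, except at the
    origin. The form 0 + (-1) * \<xi> is that of the affine change of variables.\<close>
  have "integrable lborel (\<lambda>\<xi>. ?f \<xi> + ?f (0 + (-1) * \<xi>))"
    using I by (intro Bochner_Integration.integrable_add lborel_integrable_real_affine) auto
  then show ?thesis
  proof (rule integrable_cong_AE_imp)
    show "AE \<xi> in lborel. ?f \<xi> + ?f (0 + (-1) * \<xi>) = \<bar>\<xi>\<bar> ^ m * exp (- (t * \<bar>\<xi>\<bar> powr \<alpha>))"
      using AE_lborel_singleton[of 0]
      by eventually_elim (auto simp: indicator_def powr_realpow split: if_splits)
  qed measurable
qed

section \<open>Decay of the half-line Fourier integral\<close>

text \<open>The exponential of the kernel at t = 1, for \<xi> > 0 only, hence without an absolute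
  value under \<open>powr\<close>. On the half line it is smooth, whereas |\<xi>|^\<alpha> is in
  general not smooth at the origin.\<close>

definition osc :: "real \<Rightarrow> real \<Rightarrow> real \<Rightarrow> real \<Rightarrow> complex" where
  "osc \<alpha> x s \<xi> = exp (\<i> * complex_of_real (x * \<xi> + s * \<xi> ^ 3) - complex_of_real (\<xi> powr \<alpha>))"

lemma norm_osc: "norm (osc \<alpha> x s \<xi>) = exp (- (\<xi> powr \<alpha>))"
  by (simp add: osc_def norm_exp_eq_Re)

lemma osc_has_vector_derivative:
  assumes "0 < \<xi>"
  shows "(osc \<alpha> x s has_vector_derivative
    (\<i> * complex_of_real (x + 3 * s * \<xi>\<^sup>2) - complex_of_real (\<alpha> * \<xi> powr (\<alpha> - 1))) * osc \<alpha> x s \<xi>) (at \<xi>)"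
proof -
  have 1: "((\<lambda>\<xi>. x * \<xi> + s * \<xi> ^ 3) has_real_derivative (x + 3 * s * \<xi>\<^sup>2)) (at \<xi>)"
    by (auto intro!: derivative_eq_intros)
  have 2: "((\<lambda>\<xi>. \<xi> powr \<alpha>) has_real_derivative (\<alpha> * \<xi> powr (\<alpha> - 1))) (at \<xi>)"
    using assms by (rule has_real_derivative_powr)
  have "((\<lambda>\<xi>. \<i> * complex_of_real (x * \<xi> + s * \<xi> ^ 3) - complex_of_real (\<xi> powr \<alpha>)) has_vector_derivative
    (\<i> * complex_of_real (x + 3 * s * \<xi>\<^sup>2) - complex_of_real (\<alpha> * \<xi> powr (\<alpha> - 1)))) (at \<xi>)"
    using 1 2 by (intro has_vector_derivative_diff has_vector_derivative_mult_right has_vector_derivative_of_real)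
       (auto simp: has_real_derivative_iff_has_vector_derivative)
  from field_vector_diff_chain_at[OF this DERIV_exp] show ?thesis
    by (simp add: osc_def[abs_def] o_def)
qed

text \<open>
  With \<open>\<phi>(\<xi>) = \<xi>^(n+1) exp(is\<xi>^3 - \<xi>^\<alpha>)\<close>, the function \<open>osc_primitive\<close> is \<open>(\<phi>' - ix\<phi>) exp(ix\<xi>)\<close>, whose
  derivative is \<open>(\<phi>'' + x^2 \<phi>) exp(ix\<xi>)\<close>; this performs both integrations by parts at once.
  The term \<open>\<phi>''\<close> is \<open>osc_rest\<close> times \<open>exp(is\<xi>^3 - \<xi>^\<alpha>)\<close>.
\<close>

definition osc_primitive :: "real \<Rightarrow> real \<Rightarrow> real \<Rightarrow> nat \<Rightarrow> real \<Rightarrow> complex" where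
  "osc_primitive \<alpha> x s n \<xi> = complex_of_real (\<xi> ^ n) *
     (\<i> * complex_of_real (3 * s * \<xi> ^ 3 - x * \<xi>) + complex_of_real (real n + 1 - \<alpha> * \<xi> powr \<alpha>)) * osc \<alpha> x s \<xi>"

definition osc_rest :: "real \<Rightarrow> real \<Rightarrow> nat \<Rightarrow> real \<Rightarrow> complex" where
  "osc_rest \<alpha> s n \<xi> =
     (let q = \<i> * complex_of_real (3 * s * \<xi>\<^sup>2) - complex_of_real (\<alpha> * \<xi> powr (\<alpha> - 1)) in
      complex_of_real (real n * (real n + 1) * \<xi> ^ (n - 1))
      + complex_of_real ((2 * real n + 1) * \<xi> ^ n) * q
      + complex_of_real (\<xi> ^ n) * (\<i> * complex_of_real (9 * s * \<xi>\<^sup>2) - complex_of_real (\<alpha>\<^sup>2 * \<xi> powr (\<alpha> - 1)))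
      + complex_of_real (\<xi> ^ (n + 1)) * q\<^sup>2)"

text \<open>With q = 3is\<xi>^2 - \<alpha>\<xi>^(\<alpha>-1), the logarithmic derivative of
  exp(is\<xi>^3 - \<xi>^\<alpha>), \<open>osc_primitive\<close> is \<xi>^n (\<xi>q + n + 1 -
  ix\<xi>) times \<open>osc\<close>. The coefficients 9s and \<alpha>^2 in \<open>osc_rest\<close>
  come from (\<xi>q)' = 9is\<xi>^2 - \<alpha>^2 \<xi>^(\<alpha>-1).\<close>

lemma osc_primitive_has_vector_derivative:
  assumes "0 < \<xi>"
  shows "(osc_primitive \<alpha> x s n has_vector_derivative
    (complex_of_real (x\<^sup>2 * \<xi> ^ (n + 1)) + osc_rest \<alpha> s n \<xi>) * osc \<alpha> x s \<xi>) (at \<xi>)"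
proof -
  have 1: "((\<lambda>\<xi>. \<xi> ^ n) has_real_derivative (n * \<xi> ^ (n - 1))) (at \<xi>)"
    by (auto intro!: derivative_eq_intros)
  have 2: "((\<lambda>\<xi>. 3 * s * \<xi> ^ 3 - x * \<xi>) has_real_derivative (9 * s * \<xi>\<^sup>2 - x)) (at \<xi>)"
    by (auto intro!: derivative_eq_intros)
  have 3: "((\<lambda>\<xi>. real n + 1 - \<alpha> * \<xi> powr \<alpha>) has_real_derivative (- (\<alpha> * (\<alpha> * \<xi> powr (\<alpha> - 1))))) (at \<xi>)"
    using assms by (auto intro!: derivative_eq_intros)
  have p: "\<xi> powr \<alpha> = \<xi> * \<xi> powr (\<alpha> - 1)"
    using assms by (simp add: powr_diff)
  have n: "complex_of_real (n * \<xi> ^ n) = complex_of_real (n * \<xi> ^ (n - 1)) * complex_of_real \<xi>"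
    by (cases n) auto
  define a where "a = complex_of_real (\<xi> powr (\<alpha> - 1))"
  have "(osc_primitive \<alpha> x s n has_vector_derivative
     (complex_of_real (\<xi> ^ n) * (\<i> * complex_of_real (3 * s * \<xi> ^ 3 - x * \<xi>) + complex_of_real (real n + 1 - \<alpha> * \<xi> powr \<alpha>)) *
      ((\<i> * complex_of_real (x + 3 * s * \<xi>\<^sup>2) - complex_of_real (\<alpha> * \<xi> powr (\<alpha> - 1))) * osc \<alpha> x s \<xi>)
     + (complex_of_real (\<xi> ^ n) * (\<i> * complex_of_real (9 * s * \<xi>\<^sup>2 - x) + complex_of_real (- (\<alpha> * (\<alpha> * \<xi> powr (\<alpha> - 1)))))
       + complex_of_real (n * \<xi> ^ (n - 1)) *
         (\<i> * complex_of_real (3 * s * \<xi> ^ 3 - x * \<xi>) + complex_of_real (real n + 1 - \<alpha> * \<xi> powr \<alpha>))) * osc \<alpha> x s \<xi>)) (at \<xi>)"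
    unfolding osc_primitive_def[abs_def]
    using 1 2 3 assms
    by (intro has_vector_derivative_mult has_vector_derivative_add has_vector_derivative_mult_right
        has_vector_derivative_of_real osc_has_vector_derivative)
       (auto simp: has_real_derivative_iff_has_vector_derivative)
  also have "complex_of_real (\<xi> ^ n) * (\<i> * complex_of_real (3 * s * \<xi> ^ 3 - x * \<xi>) + complex_of_real (real n + 1 - \<alpha> * \<xi> powr \<alpha>)) *
      ((\<i> * complex_of_real (x + 3 * s * \<xi>\<^sup>2) - complex_of_real (\<alpha> * \<xi> powr (\<alpha> - 1))) * osc \<alpha> x s \<xi>)
     + (complex_of_real (\<xi> ^ n) * (\<i> * complex_of_real (9 * s * \<xi>\<^sup>2 - x) + complex_of_real (- (\<alpha> * (\<alpha> * \<xi> powr (\<alpha> - 1)))))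
       + complex_of_real (n * \<xi> ^ (n - 1)) *
         (\<i> * complex_of_real (3 * s * \<xi> ^ 3 - x * \<xi>) + complex_of_real (real n + 1 - \<alpha> * \<xi> powr \<alpha>))) * osc \<alpha> x s \<xi>
    = (complex_of_real (x\<^sup>2 * \<xi> ^ (n + 1)) + osc_rest \<alpha> s n \<xi>) * osc \<alpha> x s \<xi>"
  proof -
    define N X Y where "N = complex_of_real (n * \<xi> ^ (n - 1))" and "X = complex_of_real \<xi>" and "Y = complex_of_real (\<xi> ^ n)"
    have n': "of_nat n * Y = N * X"
      using n by (simp add: N_def X_def Y_def)
    have r: "complex_of_real (real n * (real n + 1) * \<xi> ^ (n - 1)) = (of_nat n + 1) * N"
      by (simp add: N_def)
    have e: "Y * (\<i> * (3 * of_real s * X ^ 3 - of_real x * X) + (of_nat n + 1 - of_real \<alpha> * (X * a))) *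
        (\<i> * (of_real x + 3 * of_real s * X\<^sup>2) - of_real \<alpha> * a)
      + (Y * (\<i> * (9 * of_real s * X\<^sup>2 - of_real x) - of_real \<alpha> * (of_real \<alpha> * a))
       + N * (\<i> * (3 * of_real s * X ^ 3 - of_real x * X) + (of_nat n + 1 - of_real \<alpha> * (X * a))))
      = (of_real x)\<^sup>2 * (X * Y) + ((of_nat n + 1) * N
         + ((2 * of_nat n + 1) * Y) * (\<i> * (3 * of_real s * X\<^sup>2) - of_real \<alpha> * a)
         + Y * (\<i> * (9 * of_real s * X\<^sup>2) - (of_real \<alpha>)\<^sup>2 * a)
         + (X * Y) * (\<i> * (3 * of_real s * X\<^sup>2) - of_real \<alpha> * a)\<^sup>2)"
      (is "?L = ?R")
    proof -
      \<comment> \<open>Treating n\<xi>^(n-1) as an independent variable N avoids the truncated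
        exponent n - 1 at n = 0. The two sides then differ by a multiple of N X - n Y, which
        vanishes by n'.\<close>
      have "?L - ?R = (N * X - of_nat n * Y) * (\<i> * (3 * of_real s * X\<^sup>2) - \<i> * of_real x - of_real \<alpha> * a)"
        by (simp add: algebra_simps power2_eq_square power3_eq_cube)
      then show ?thesis using n' by simp
    qed
    show ?thesis
      unfolding osc_rest_def Let_def r p
        mult.assoc[symmetric] ring_distribs(2)[symmetric]
      unfolding mult.assoc
      using arg_cong[OF e, of "\<lambda>z. z * osc \<alpha> x s \<xi>"]
      by (simp add: X_def Y_def N_def a_def algebra_simps)
  qed
  finally show ?thesis .
qed

text \<open>The boundary value is \<phi>'(0+) for \<phi>(\<xi>) = \<xi>^(n+1) exp(is\<xi>^3 -
  \<xi>^\<alpha>), nonzero only for n = 0. It does not depend on x or s, so it does not spoil the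
  uniform bound.\<close>

lemma osc_primitive_tendsto_at_right_0:
  assumes "0 < \<alpha>"
  shows "(osc_primitive \<alpha> x s n \<longlongrightarrow> complex_of_real (0 ^ n * (real n + 1))) (at_right 0)"
proof -
  have id: "((\<lambda>\<xi>::real. \<xi>) \<longlongrightarrow> 0) (at_right 0)"
    by (rule tendsto_ident_at)
  have p: "((\<lambda>\<xi>. \<xi> powr \<alpha>) \<longlongrightarrow> 0) (at_right 0)"
    using tendsto_powr'[OF id tendsto_const, of \<alpha>] assms
    by (auto simp: eventually_at_right_less eventually_at_filter)
  have "(osc_primitive \<alpha> x s n \<longlongrightarrow> complex_of_real (0 ^ n) *
      (\<i> * complex_of_real (3 * s * 0 ^ 3 - x * 0) + complex_of_real (real n + 1 - \<alpha> * 0))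
      * exp (\<i> * complex_of_real (x * 0 + s * 0 ^ 3) - complex_of_real 0)) (at_right 0)"
    unfolding osc_primitive_def[abs_def] osc_def by (intro tendsto_intros id p)
  then show ?thesis by simp
qed

lemma osc_primitive_tendsto_at_top:
  assumes "0 < \<alpha>"
  shows "(osc_primitive \<alpha> x s n \<longlongrightarrow> 0) at_top"
proof -
  let ?g = "\<lambda>b \<xi>. \<xi> powr b * exp (- (1 * \<xi> powr \<alpha>))"
  let ?B = "\<lambda>\<xi>. 3 * \<bar>s\<bar> * ?g (real n + 3) \<xi> + \<bar>x\<bar> * ?g (real n + 1) \<xi> + (real n + 1) * ?g n \<xi> + \<alpha> * ?g (real n + \<alpha>) \<xi>"
  have "(?B \<longlongrightarrow> 3 * \<bar>s\<bar> * 0 + \<bar>x\<bar> * 0 + (real n + 1) * 0 + \<alpha> * 0) at_top"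
    by (intro tendsto_intros powr_mult_exp_tendsto_0 assms) auto
  then have lim: "(?B \<longlongrightarrow> 0) at_top" by simp
  have "norm (osc_primitive \<alpha> x s n \<xi>) \<le> ?B \<xi>" if "1 \<le> \<xi>" for \<xi>
  proof -
    have "norm (osc_primitive \<alpha> x s n \<xi>)
      \<le> \<xi> ^ n * ((3 * \<bar>s\<bar> * \<xi> ^ 3 + \<bar>x\<bar> * \<xi>) + (real n + 1 + \<alpha> * \<xi> powr \<alpha>)) * exp (- (\<xi> powr \<alpha>))"
      unfolding osc_primitive_def norm_mult norm_osc
    proof (intro mult_right_mono mult_mono norm_triangle_le add_mono)
      have "\<bar>3 * s * \<xi> ^ 3 - x * \<xi>\<bar> \<le> \<bar>3 * s * \<xi> ^ 3\<bar> + \<bar>x * \<xi>\<bar>"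
        by (rule abs_triangle_ineq4)
      then show "norm (\<i> * complex_of_real (3 * s * \<xi> ^ 3 - x * \<xi>)) \<le> 3 * \<bar>s\<bar> * \<xi> ^ 3 + \<bar>x\<bar> * \<xi>"
        using that unfolding norm_mult norm_of_real by (simp add: abs_mult)
      have "\<bar>real n + 1 - \<alpha> * \<xi> powr \<alpha>\<bar> \<le> \<bar>real n + 1\<bar> + \<bar>\<alpha> * \<xi> powr \<alpha>\<bar>"
        by (rule abs_triangle_ineq4)
      then show "norm (complex_of_real (real n + 1 - \<alpha> * \<xi> powr \<alpha>)) \<le> real n + 1 + \<alpha> * \<xi> powr \<alpha>"
        unfolding norm_of_real using assms by (simp add: abs_mult)
    qed (use that in \<open>auto simp: norm_power\<close>)
    also have "\<dots> = ?B \<xi>"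
      using that by (simp add: powr_add powr_realpow algebra_simps power3_eq_cube powr_numeral)
    finally show ?thesis .
  qed
  then show ?thesis
    by (intro Lim_null_comparison[OF _ lim] eventually_at_top_linorderI[of 1]) auto
qed

text \<open>The terms of \<open>osc_rest\<close> are bounded separately, with (a+b)^2 \<le>
  2(a^2+b^2) for the square. The right side is written with \<open>powr\<close> so that each term
  can be integrated on the half line. Its exponents all exceed -1, except n - 1 at n = 0, where the
  coefficient vanishes.\<close>

lemma norm_osc_rest_le:
  assumes "0 < \<alpha>" "\<bar>s\<bar> \<le> 1" "0 < \<xi>"
  shows "norm (osc_rest \<alpha> s n \<xi>) \<le>
    real n * (real n + 1) * \<xi> powr (real n - 1) + (3 * (2 * real n + 1) + 9) * \<xi> powr (real n + 2)
    + ((2 * real n + 1) * \<alpha> + \<alpha>\<^sup>2) * \<xi> powr (real n + \<alpha> - 1) + 18 * \<xi> powr (real n + 5)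
    + 2 * \<alpha>\<^sup>2 * \<xi> powr (real n + 2 * \<alpha> - 1)"
proof -
  define a where "a = \<xi> powr (\<alpha> - 1)"
  define q where "q = \<i> * complex_of_real (3 * s * \<xi>\<^sup>2) - complex_of_real (\<alpha> * a)"
  define b where "b = \<i> * complex_of_real (9 * s * \<xi>\<^sup>2) - complex_of_real (\<alpha>\<^sup>2 * a)"
  have a: "0 \<le> a" by (simp add: a_def)
  have s: "\<bar>s\<bar> * \<xi>\<^sup>2 \<le> \<xi>\<^sup>2" using assms by (simp add: mult_left_le_one_le)
  have "norm q \<le> norm (\<i> * complex_of_real (3 * s * \<xi>\<^sup>2)) + norm (complex_of_real (\<alpha> * a))"
    unfolding q_def by (rule norm_triangle_ineq4)
  also have "\<dots> = 3 * (\<bar>s\<bar> * \<xi>\<^sup>2) + \<alpha> * a"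
    using a assms unfolding norm_mult norm_of_real by (simp add: abs_mult)
  also have "\<dots> \<le> 3 * \<xi>\<^sup>2 + \<alpha> * a"
    using s by simp
  finally have q: "norm q \<le> 3 * \<xi>\<^sup>2 + \<alpha> * a" .
  have "norm b \<le> norm (\<i> * complex_of_real (9 * s * \<xi>\<^sup>2)) + norm (complex_of_real (\<alpha>\<^sup>2 * a))"
    unfolding b_def by (rule norm_triangle_ineq4)
  also have "\<dots> = 9 * (\<bar>s\<bar> * \<xi>\<^sup>2) + \<alpha>\<^sup>2 * a"
    using a assms unfolding norm_mult norm_of_real by (simp add: abs_mult)
  also have "\<dots> \<le> 9 * \<xi>\<^sup>2 + \<alpha>\<^sup>2 * a"
    using s by simp
  finally have b: "norm b \<le> 9 * \<xi>\<^sup>2 + \<alpha>\<^sup>2 * a" .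
  have q2: "(norm q)\<^sup>2 \<le> 2 * (9 * \<xi> ^ 4 + \<alpha>\<^sup>2 * a\<^sup>2)"
  proof -
    have "(norm q)\<^sup>2 \<le> (3 * \<xi>\<^sup>2 + \<alpha> * a)\<^sup>2"
      using q by (intro power_mono) auto
    also have "\<dots> \<le> 2 * ((3 * \<xi>\<^sup>2)\<^sup>2 + (\<alpha> * a)\<^sup>2)"
      using sum_squares_bound[of "3 * \<xi>\<^sup>2" "\<alpha> * a"] by (simp add: power2_sum)
    finally show ?thesis by (simp add: power_mult_distrib)
  qed
  have "osc_rest \<alpha> s n \<xi> = complex_of_real (real n * (real n + 1) * \<xi> ^ (n - 1))
      + complex_of_real ((2 * real n + 1) * \<xi> ^ n) * q + complex_of_real (\<xi> ^ n) * b
      + complex_of_real (\<xi> ^ (n + 1)) * q\<^sup>2"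
    by (simp add: osc_rest_def Let_def q_def b_def a_def)
  also have "norm \<dots> \<le> real n * (real n + 1) * \<xi> ^ (n - 1)
      + (2 * real n + 1) * \<xi> ^ n * (3 * \<xi>\<^sup>2 + \<alpha> * a) + \<xi> ^ n * (9 * \<xi>\<^sup>2 + \<alpha>\<^sup>2 * a)
      + \<xi> ^ (n + 1) * (2 * (9 * \<xi> ^ 4 + \<alpha>\<^sup>2 * a\<^sup>2))"
  proof (intro norm_triangle_le add_mono)
    show "norm (complex_of_real (real n * (real n + 1) * \<xi> ^ (n - 1))) \<le> real n * (real n + 1) * \<xi> ^ (n - 1)"
      using assms unfolding norm_of_real by simp
    show "norm (complex_of_real ((2 * real n + 1) * \<xi> ^ n) * q) \<le> (2 * real n + 1) * \<xi> ^ n * (3 * \<xi>\<^sup>2 + \<alpha> * a)"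
      using assms q unfolding norm_mult norm_of_real by (intro mult_mono) (auto simp: abs_mult)
    show "norm (complex_of_real (\<xi> ^ n) * b) \<le> \<xi> ^ n * (9 * \<xi>\<^sup>2 + \<alpha>\<^sup>2 * a)"
      using assms b unfolding norm_mult norm_of_real by (intro mult_mono) auto
    show "norm (complex_of_real (\<xi> ^ (n + 1)) * q\<^sup>2) \<le> \<xi> ^ (n + 1) * (2 * (9 * \<xi> ^ 4 + \<alpha>\<^sup>2 * a\<^sup>2))"
      using assms q2 unfolding norm_mult norm_of_real norm_power by (intro mult_mono) auto
  qed
  also have "\<dots> = real n * (real n + 1) * \<xi> powr (real n - 1) + (3 * (2 * real n + 1) + 9) * \<xi> powr (real n + 2)
    + ((2 * real n + 1) * \<alpha> + \<alpha>\<^sup>2) * \<xi> powr (real n + \<alpha> - 1) + 18 * \<xi> powr (real n + 5)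
    + 2 * \<alpha>\<^sup>2 * \<xi> powr (real n + 2 * \<alpha> - 1)"
  proof -
    have 1: "real n * (real n + 1) * \<xi> ^ (n - 1) = real n * (real n + 1) * \<xi> powr (real n - 1)"
      using assms by (cases n) (auto simp: powr_realpow)
    have 2: "\<xi> powr (real n + 2) = \<xi> ^ n * \<xi>\<^sup>2" "\<xi> powr (real n + 5) = \<xi> ^ (n + 1) * \<xi> ^ 4"
      using assms by (simp_all add: powr_add powr_realpow powr_numeral eval_nat_numeral)
    have 3: "\<xi> powr (real n + \<alpha> - 1) = \<xi> ^ n * a"
      using assms by (simp add: a_def powr_add powr_diff powr_realpow)
    have "real n + 2 * \<alpha> - 1 = real (n + 1) + ((\<alpha> - 1) + (\<alpha> - 1))"
      by simp
    then have 4: "\<xi> powr (real n + 2 * \<alpha> - 1) = \<xi> ^ (n + 1) * a\<^sup>2"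
      using assms by (simp only: a_def powr_add powr_realpow power2_eq_square)
    show ?thesis
      unfolding 1 2 3 4 by (simp add: algebra_simps)
  qed
  finally show ?thesis .
qed

text \<open>The majorant depends neither on x nor on s; this is the source of the uniformity in the
  kernel bounds.\<close>

lemma integrable_osc_rest:
  assumes "0 < \<alpha>"
  obtains W where "integrable lborel W"
    "\<And>s x \<xi>. \<bar>s\<bar> \<le> 1 \<Longrightarrow> norm (indicator {0<..} \<xi> *\<^sub>R (osc_rest \<alpha> s n \<xi> * osc \<alpha> x s \<xi>)) \<le> W \<xi>"
proof -
  let ?g = "\<lambda>b \<xi>. indicator {0<..} \<xi> * (\<xi> powr b * exp (- (1 * \<xi> powr \<alpha>)))"
  let ?W = "\<lambda>\<xi>. real n * (real n + 1) * ?g (real n - 1) \<xi> + (3 * (2 * real n + 1) + 9) * ?g (real n + 2) \<xi>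
    + ((2 * real n + 1) * \<alpha> + \<alpha>\<^sup>2) * ?g (real n + \<alpha> - 1) \<xi> + 18 * ?g (real n + 5) \<xi>
    + 2 * \<alpha>\<^sup>2 * ?g (real n + 2 * \<alpha> - 1) \<xi>"
  show ?thesis
  proof (rule that[of ?W])
    have g: "integrable lborel (?g b)" if "-1 < b" for b
      using assms that by (intro integrable_powr_mult_exp) auto
    \<comment> \<open>At n = 0 the exponent is -1, just outside the integrable range, but the
      coefficient is 0.\<close>
    have "integrable lborel (\<lambda>\<xi>. real n * (real n + 1) * ?g (real n - 1) \<xi>)"
      by (cases n) (auto intro!: integrable_mult_right g[simplified])
    then show "integrable lborel ?W"
      using assms by (intro Bochner_Integration.integrable_add integrable_mult_right g) auto
    fix s x \<xi> :: real assume s: "\<bar>s\<bar> \<le> 1"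
    show "norm (indicator {0<..} \<xi> *\<^sub>R (osc_rest \<alpha> s n \<xi> * osc \<alpha> x s \<xi>)) \<le> ?W \<xi>"
    proof (cases "0 < \<xi>")
      case True
      then show ?thesis
        using mult_right_mono[OF norm_osc_rest_le[OF assms s True, of n], of "exp (- (\<xi> powr \<alpha>))"]
        by (simp add: norm_mult norm_osc algebra_simps)
    qed simp
  qed
qed

text \<open>The fundamental theorem of calculus for \<open>osc_primitive\<close> expresses x^2 times
  the integral through a boundary value and the integral of the rest, both bounded uniformly in x
  and s. Negative s are included because the reflection of the other half line changes the sign of
  s.\<close>

lemma half_line_fourier_bound:
  assumes "0 < \<alpha>"
  obtains C where "0 \<le> C"
    "\<And>s x. \<bar>s\<bar> \<le> 1 \<Longrightarrow>
      norm (LINT \<xi>|lborel. indicator {0<..} \<xi> *\<^sub>R (complex_of_real (\<xi> ^ (n + 1)) * osc \<alpha> x s \<xi>)) * (1 + x\<^sup>2) \<le> C"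
proof -
  obtain W where W: "integrable lborel W"
    "\<And>s x \<xi>. \<bar>s\<bar> \<le> 1 \<Longrightarrow> norm (indicator {0<..} \<xi> *\<^sub>R (osc_rest \<alpha> s n \<xi> * osc \<alpha> x s \<xi>)) \<le> W \<xi>"
    using integrable_osc_rest[OF assms] by metis
  let ?g = "\<lambda>\<xi>. indicator {0<..} \<xi> * (\<xi> powr (real n + 1) * exp (- (1 * \<xi> powr \<alpha>)))"
  have g: "integrable lborel ?g"
    using assms by (intro integrable_powr_mult_exp) auto
  \<comment> \<open>The first summand pays for the 1 in 1 + x^2. The boundary value and the rest pay
    for x^2.\<close>
  define C where "C = (LINT \<xi>|lborel. ?g \<xi>) + (real n + 1) + (LINT \<xi>|lborel. W \<xi>)"
  have main: "norm (LINT \<xi>|lborel. indicator {0<..} \<xi> *\<^sub>R (complex_of_real (\<xi> ^ (n + 1)) * osc \<alpha> x s \<xi>)) * (1 + x\<^sup>2) \<le> C"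
    if s: "\<bar>s\<bar> \<le> 1" for s x
  proof -
    let ?f = "\<lambda>\<xi>. indicator {0<..} \<xi> *\<^sub>R (complex_of_real (\<xi> ^ (n + 1)) * osc \<alpha> x s \<xi>)"
    let ?r = "\<lambda>\<xi>. indicator {0<..} \<xi> *\<^sub>R (osc_rest \<alpha> s n \<xi> * osc \<alpha> x s \<xi>)"
    let ?F = "\<lambda>\<xi>. (complex_of_real (x\<^sup>2 * \<xi> ^ (n + 1)) + osc_rest \<alpha> s n \<xi>) * osc \<alpha> x s \<xi>"
    have nf: "norm (?f \<xi>) = ?g \<xi>" for \<xi>
      by (auto simp: indicator_def norm_mult norm_osc norm_power powr_add powr_realpow)
    have f: "integrable lborel ?f"
    proof (rule Bochner_Integration.integrable_bound[OF g])
      show "?f \<in> borel_measurable lborel"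
        unfolding osc_def by measurable
      show "AE \<xi> in lborel. norm (?f \<xi>) \<le> norm (?g \<xi>)"
        unfolding nf by (intro AE_I2) simp
    qed
    have r: "integrable lborel ?r"
    proof (rule Bochner_Integration.integrable_bound[OF W(1)])
      show "?r \<in> borel_measurable lborel"
        unfolding osc_rest_def osc_def Let_def by measurable
      show "AE \<xi> in lborel. norm (?r \<xi>) \<le> norm (W \<xi>)"
        using W(2)[OF s] by (intro AE_I2) (smt (verit) real_norm_def)
    qed
    have F: "indicator {0<..} \<xi> *\<^sub>R ?F \<xi> = x\<^sup>2 *\<^sub>R ?f \<xi> + ?r \<xi>" for \<xi>
      by (simp add: indicator_def algebra_simps scaleR_conv_of_real)
    have ei: "einterval 0 \<infinity> = {0<..}"
      by (auto simp: einterval_def)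
    have "(LBINT \<xi>=0..\<infinity>. ?F \<xi>) = (LINT \<xi>|lborel. x\<^sup>2 *\<^sub>R ?f \<xi> + ?r \<xi>)"
      unfolding interval_lebesgue_integral_def set_lebesgue_integral_def ei F by simp
    also have "\<dots> = x\<^sup>2 *\<^sub>R (LINT \<xi>|lborel. ?f \<xi>) + (LINT \<xi>|lborel. ?r \<xi>)"
      using f r by (subst Bochner_Integration.integral_add) (auto intro: integrable_scaleR_right simp del: scaleR_scaleR)
    \<comment> \<open>The primitive tends to 0 at infinity, so only its limit at 0+
      survives.\<close>
    also have "(LBINT \<xi>=0..\<infinity>. ?F \<xi>) = 0 - complex_of_real (0 ^ n * (real n + 1))"
    proof (rule interval_integral_FTC_integrable)
      show "(osc_primitive \<alpha> x s n has_vector_derivative ?F \<xi>) (at \<xi>)" if "0 < ereal \<xi>" for \<xi>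
        using that by (intro osc_primitive_has_vector_derivative) auto
      show "isCont ?F \<xi>" if "0 < ereal \<xi>" for \<xi>
        using that unfolding osc_rest_def osc_def Let_def
        by (intro continuous_intros) auto
      show "set_integrable lborel (einterval 0 \<infinity>) ?F"
        unfolding set_integrable_def ei F
        using f r by (intro Bochner_Integration.integrable_add integrable_scaleR_right)
      show "((osc_primitive \<alpha> x s n \<circ> real_of_ereal) \<longlongrightarrow> complex_of_real (0 ^ n * (real n + 1))) (at_right 0)"
        using osc_primitive_tendsto_at_right_0[OF assms] unfolding zero_ereal_def ereal_tendsto_simps .
      show "((osc_primitive \<alpha> x s n \<circ> real_of_ereal) \<longlongrightarrow> 0) (at_left \<infinity>)"
        using osc_primitive_tendsto_at_top[OF assms] unfolding ereal_tendsto_simps .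
    qed auto
    finally have eq: "x\<^sup>2 *\<^sub>R (LINT \<xi>|lborel. ?f \<xi>) = - complex_of_real (0 ^ n * (real n + 1)) - (LINT \<xi>|lborel. ?r \<xi>)"
      by (simp only: eq_diff_eq diff_0)
    have "norm (LINT \<xi>|lborel. ?f \<xi>) * x\<^sup>2 = norm (x\<^sup>2 *\<^sub>R (LINT \<xi>|lborel. ?f \<xi>))"
      by simp
    also have "\<dots> \<le> norm (- complex_of_real (0 ^ n * (real n + 1))) + norm (LINT \<xi>|lborel. ?r \<xi>)"
      unfolding eq by (rule norm_triangle_ineq4)
    also have "\<dots> \<le> (real n + 1) + (LINT \<xi>|lborel. W \<xi>)"
    proof (rule add_mono)
      show "norm (- complex_of_real (0 ^ n * (real n + 1))) \<le> real n + 1"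
        unfolding norm_minus_cancel norm_of_real by (cases n) auto
      show "norm (LINT \<xi>|lborel. ?r \<xi>) \<le> (LINT \<xi>|lborel. W \<xi>)"
        by (rule Bochner_Integration.integral_norm_bound_integral[OF r W(1) W(2)[OF s]])
    qed
    finally have "norm (LINT \<xi>|lborel. ?f \<xi>) * x\<^sup>2 \<le> (real n + 1) + (LINT \<xi>|lborel. W \<xi>)" .
    moreover have "norm (LINT \<xi>|lborel. ?f \<xi>) \<le> (LINT \<xi>|lborel. ?g \<xi>)"
      by (rule Bochner_Integration.integral_norm_bound_integral[OF f g]) (simp only: nf order_refl)
    ultimately show ?thesis by (simp add: C_def algebra_simps)
  qed
  show ?thesis
    \<comment> \<open>Nonnegativity of C is read off from the bound itself at s = x = 0.\<close>
    by (rule that[OF order_trans[OF _ main[of 0 0]] main]) auto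
qed

section \<open>The oscillatory kernels\<close>

definition osc_symbol :: "real \<Rightarrow> real \<Rightarrow> real \<Rightarrow> nat \<Rightarrow> real \<Rightarrow> real \<Rightarrow> complex" where
  "osc_symbol \<alpha> s t m x \<xi> = (\<i> * complex_of_real \<xi>) ^ m *
     exp (\<i> * complex_of_real (x * \<xi> + s * \<xi> ^ 3) - complex_of_real (t * \<bar>\<xi>\<bar> powr \<alpha>))"

definition osc_kernel :: "real \<Rightarrow> real \<Rightarrow> real \<Rightarrow> nat \<Rightarrow> real \<Rightarrow> complex" where
  "osc_kernel \<alpha> s t m x = complex_of_real (1 / (2 * pi)) * (LINT \<xi>|lborel. osc_symbol \<alpha> s t m x \<xi>)"

lemma S_kernel_eq_osc_kernel: "S_kernel \<alpha> t = osc_kernel \<alpha> t t 0"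
  by (rule ext) (simp add: S_kernel_def osc_kernel_def osc_symbol_def exp_add[symmetric] algebra_simps)

lemma G_kernel_eq_osc_kernel: "G_kernel \<alpha> t = osc_kernel \<alpha> 0 t 0"
  by (rule ext) (simp add: G_kernel_def osc_kernel_def osc_symbol_def exp_add[symmetric] algebra_simps)

lemma norm_osc_symbol: "norm (osc_symbol \<alpha> s t m x \<xi>) = \<bar>\<xi>\<bar> ^ m * exp (- (t * \<bar>\<xi>\<bar> powr \<alpha>))"
  by (simp add: osc_symbol_def norm_mult norm_power norm_exp_eq_Re)

lemma osc_symbol_measurable [measurable]:
  assumes [measurable]: "s \<in> borel_measurable M" "x \<in> borel_measurable M" "\<xi> \<in> borel_measurable M"
  shows "(\<lambda>w. osc_symbol \<alpha> (s w) t m (x w) (\<xi> w)) \<in> borel_measurable M"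
  unfolding osc_symbol_def by measurable

text \<open>Allowing s and x to be measurable functions gives joint measurability, which the Tonelli
  arguments need.\<close>

lemma osc_kernel_measurable [measurable]:
  assumes [measurable]: "s \<in> borel_measurable M" "x \<in> borel_measurable M"
  shows "(\<lambda>w. osc_kernel \<alpha> (s w) t m (x w)) \<in> borel_measurable M"
  unfolding osc_kernel_def by measurable

lemma integrable_osc_symbol:
  assumes "0 < \<alpha>" "0 < t"
  shows "integrable lborel (osc_symbol \<alpha> s t m x)"
  by (rule Bochner_Integration.integrable_bound[OF integrable_abs_power_mult_exp[OF assms, of m]])
    (auto simp: norm_osc_symbol)

lemma osc_kernel_deriv_x:
  assumes "0 < \<alpha>" "0 < t"
  shows "(osc_kernel \<alpha> s t m has_vector_derivative osc_kernel \<alpha> s t (Suc m) x) (at x)"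
  unfolding osc_kernel_def[abs_def]
proof (intro has_vector_derivative_mult_right integral_has_vector_derivative_dominated)
  show "integrable lborel (\<lambda>\<xi>. \<bar>\<xi>\<bar> ^ Suc m * exp (- (t * \<bar>\<xi>\<bar> powr \<alpha>)))"
    using assms by (rule integrable_abs_power_mult_exp)
  fix x \<xi> :: real
  have "((\<lambda>x. \<i> * complex_of_real (x * \<xi> + s * \<xi> ^ 3) - complex_of_real (t * \<bar>\<xi>\<bar> powr \<alpha>))
      has_vector_derivative \<i> * complex_of_real \<xi> - 0) (at x)"
    by (intro has_vector_derivative_diff has_vector_derivative_mult_right has_vector_derivative_of_real
        has_vector_derivative_const)
      (auto intro!: derivative_eq_intros simp: has_real_derivative_iff_has_vector_derivative[symmetric])
  from has_vector_derivative_mult_right[OF field_vector_diff_chain_at[OF this DERIV_exp], of "(\<i> * complex_of_real \<xi>) ^ m"]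
  show "((\<lambda>x. osc_symbol \<alpha> s t m x \<xi>) has_vector_derivative osc_symbol \<alpha> s t (Suc m) x \<xi>) (at x)"
    by (simp add: osc_symbol_def[abs_def] o_def mult_ac)
qed (use assms in \<open>auto simp: norm_osc_symbol intro: integrable_osc_symbol\<close>)

text \<open>The factor produced is \<i>\<xi>^3 = -(\<i>\<xi>)^3: the kernels solve the linear
  equation K_s = -K_xxx.\<close>

lemma osc_kernel_deriv_s:
  assumes "0 < \<alpha>" "0 < t"
  shows "((\<lambda>s. osc_kernel \<alpha> s t m x) has_vector_derivative - osc_kernel \<alpha> s t (m + 3) x) (at s)"
proof -
  have "((\<lambda>s. LINT \<xi>|lborel. osc_symbol \<alpha> s t m x \<xi>) has_vector_derivative
      (LINT \<xi>|lborel. - osc_symbol \<alpha> s t (m + 3) x \<xi>)) (at s)"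
  proof (rule integral_has_vector_derivative_dominated)
    show "integrable lborel (\<lambda>\<xi>. \<bar>\<xi>\<bar> ^ (m + 3) * exp (- (t * \<bar>\<xi>\<bar> powr \<alpha>)))"
      using assms by (rule integrable_abs_power_mult_exp)
    fix s \<xi> :: real
    have "((\<lambda>s. \<i> * complex_of_real (x * \<xi> + s * \<xi> ^ 3) - complex_of_real (t * \<bar>\<xi>\<bar> powr \<alpha>))
        has_vector_derivative \<i> * complex_of_real (\<xi> ^ 3) - 0) (at s)"
      by (intro has_vector_derivative_diff has_vector_derivative_mult_right has_vector_derivative_of_real
          has_vector_derivative_const)
        (auto intro!: derivative_eq_intros simp: has_real_derivative_iff_has_vector_derivative[symmetric])
    from has_vector_derivative_mult_right[OF field_vector_diff_chain_at[OF this DERIV_exp], of "(\<i> * complex_of_real \<xi>) ^ m"]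
    moreover have "\<i> ^ 3 = - \<i>" by (simp add: power3_eq_cube)
    ultimately show "((\<lambda>s. osc_symbol \<alpha> s t m x \<xi>) has_vector_derivative - osc_symbol \<alpha> s t (m + 3) x \<xi>) (at s)"
      by (simp add: osc_symbol_def[abs_def] o_def mult_ac power_add power_mult_distrib)
  qed (use assms in \<open>auto simp: norm_osc_symbol intro: integrable_osc_symbol\<close>)
  from has_vector_derivative_mult_right[OF this, of "complex_of_real (1 / (2 * pi))"]
  show ?thesis by (simp add: osc_kernel_def)
qed

text \<open>The substitution \<xi> \<mapsto> t^(-1/\<alpha>) \<xi> normalises the dissipation. The
  power \<xi>^m contributes m factors t^(-1/\<alpha>), the Jacobian one more, and \<xi>^3 rescales s
  by t^(-3/\<alpha>).\<close>

lemma osc_kernel_scale: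
  assumes "0 < t" "0 < \<alpha>"
  shows "osc_kernel \<alpha> s t m x =
    complex_of_real (t powr (- (real m + 1) / \<alpha>)) * osc_kernel \<alpha> (s * t powr (- 3 / \<alpha>)) 1 m (t powr (- 1 / \<alpha>) * x)"
proof -
  define c where "c = t powr (- 1 / \<alpha>)"
  have c: "0 < c" using assms by (simp add: c_def)
  have c3: "t powr (- 3 / \<alpha>) = c ^ 3"
    using assms by (simp add: c_def powr_realpow[symmetric] powr_powr)
  have cm: "t powr (- (real m + 1) / \<alpha>) = c ^ Suc m"
  proof -
    have "- (real m + 1) / \<alpha> = - 1 / \<alpha> * real (Suc m)"
      using assms by (simp add: field_simps)
    then show ?thesis
      using c by (simp only: powr_powr[symmetric] c_def[symmetric] powr_realpow)
  qed
  have ca: "t * c powr \<alpha> = 1"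
  proof -
    have "c powr \<alpha> = t powr (-1)"
      unfolding c_def powr_powr using assms by simp
    then show ?thesis using assms by (simp add: powr_neg_one)
  qed
  have e: "osc_symbol \<alpha> s t m x (0 + c * \<xi>) = complex_of_real (c ^ m) * osc_symbol \<alpha> (s * c ^ 3) 1 m (c * x) \<xi>" for \<xi>
  proof -
    have "t * \<bar>c * \<xi>\<bar> powr \<alpha> = (t * c powr \<alpha>) * \<bar>\<xi>\<bar> powr \<alpha>"
      using c by (simp add: abs_mult powr_mult)
    then have "t * \<bar>c * \<xi>\<bar> powr \<alpha> = \<bar>\<xi>\<bar> powr \<alpha>" using ca by simp
    then show ?thesis
      by (simp add: osc_symbol_def power_mult_distrib mult_ac)
  qed
  have "(LINT \<xi>|lborel. osc_symbol \<alpha> s t m x \<xi>) = \<bar>c\<bar> *\<^sub>R (LINT \<xi>|lborel. osc_symbol \<alpha> s t m x (0 + c * \<xi>))"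
    using c by (intro lborel_integral_real_affine) auto
  then show ?thesis
    using c unfolding e c3 cm osc_kernel_def c_def[symmetric] by (simp add: scaleR_conv_of_real mult_ac)
qed

text \<open>The line is cut at the origin, where |\<xi>|^\<alpha> is singular. Reflecting the
  negative half turns it into a half-line integral with -s and -x. The condition m > 0 supplies the
  factor \<xi>^(n+1) of the half-line bound.\<close>

lemma osc_kernel_unit_bound:
  assumes "0 < \<alpha>" "0 < m"
  obtains C where "0 \<le> C" "\<And>s x. \<bar>s\<bar> \<le> 1 \<Longrightarrow> norm (osc_kernel \<alpha> s 1 m x) \<le> C * inverse (1 + x\<^sup>2)"
proof -
  obtain n where m: "m = n + 1" using assms by (metis Suc_eq_plus1 gr0_implies_Suc)
  let ?f = "\<lambda>s x \<xi>. indicator {0<..} \<xi> *\<^sub>R (complex_of_real (\<xi> ^ (n + 1)) * osc \<alpha> x s \<xi>)"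
  obtain C where C: "0 \<le> C"
    "\<And>s x. \<bar>s\<bar> \<le> 1 \<Longrightarrow> norm (LINT \<xi>|lborel. ?f s x \<xi>) * (1 + x\<^sup>2) \<le> C"
    using half_line_fourier_bound[OF assms(1)] by metis
  have int: "integrable lborel (?f s x)" for s x
  proof (rule Bochner_Integration.integrable_bound[OF integrable_abs_power_mult_exp[OF assms(1) zero_less_one, of m]])
    show "?f s x \<in> borel_measurable lborel"
      unfolding osc_def by measurable
    have "norm (?f s x \<xi>) \<le> norm (\<bar>\<xi>\<bar> ^ m * exp (- (1 * \<bar>\<xi>\<bar> powr \<alpha>)))" for \<xi>
    proof (cases "0 < \<xi>")
      case True
      then show ?thesis by (simp add: norm_mult norm_osc norm_power m)
    next
      case False
      then have "?f s x \<xi> = 0" by simp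
      then show ?thesis by (simp only: norm_zero norm_ge_zero)
    qed
    then show "AE \<xi> in lborel. norm (?f s x \<xi>) \<le> norm (\<bar>\<xi>\<bar> ^ m * exp (- (1 * \<bar>\<xi>\<bar> powr \<alpha>)))"
      by simp
  qed
  have bound: "norm (osc_kernel \<alpha> s 1 m x) \<le> C * inverse (1 + x\<^sup>2)" if s: "\<bar>s\<bar> \<le> 1" for s x
  proof -
    have "(LINT \<xi>|lborel. osc_symbol \<alpha> s 1 m x \<xi>)
      = (LINT \<xi>|lborel. \<i> ^ m * ?f s x \<xi> + (- \<i>) ^ m * ?f (- s) (- x) (0 + (-1) * \<xi>))"
    proof (rule integral_cong_AE)
      show "AE \<xi> in lborel. osc_symbol \<alpha> s 1 m x \<xi> = \<i> ^ m * ?f s x \<xi> + (- \<i>) ^ m * ?f (- s) (- x) (0 + (-1) * \<xi>)"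
        using AE_lborel_singleton[of 0]
      proof eventually_elim
        case (elim \<xi>)
        have "(\<i> * complex_of_real \<xi>) ^ m = (- \<i>) ^ m * complex_of_real ((- \<xi>) ^ m)"
          by (simp add: power_mult_distrib[symmetric])
        moreover have "(\<i> * complex_of_real \<xi>) ^ m = \<i> ^ m * complex_of_real (\<xi> ^ m)"
          by (simp add: power_mult_distrib)
        ultimately show ?case
          using elim unfolding m osc_symbol_def osc_def
          by (cases "0 < \<xi>") (simp_all add: indicator_def)
      qed
    qed (auto simp: osc_def)
    also have "\<dots> = \<i> ^ m * (LINT \<xi>|lborel. ?f s x \<xi>) + (- \<i>) ^ m * (LINT \<xi>|lborel. ?f (- s) (- x) (0 + (-1) * \<xi>))"
    proof -
      have i1: "integrable lborel (\<lambda>\<xi>. \<i> ^ m * ?f s x \<xi>)"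
        by (intro integrable_mult_right int)
      have i2: "integrable lborel (\<lambda>\<xi>. (- \<i>) ^ m * ?f (- s) (- x) (0 + (-1) * \<xi>))"
        by (intro integrable_mult_right lborel_integrable_real_affine[of "?f (- s) (- x)"] int) simp
      show ?thesis
        unfolding Bochner_Integration.integral_add[OF i1 i2] by (simp only: integral_mult_right_zero)
    qed
    also have "(LINT \<xi>|lborel. ?f (- s) (- x) (0 + (-1) * \<xi>)) = (LINT \<xi>|lborel. ?f (- s) (- x) \<xi>)"
      by (subst lborel_integral_real_affine[of "-1" "?f (- s) (- x)" 0]) auto
    finally have eq: "(LINT \<xi>|lborel. osc_symbol \<alpha> s 1 m x \<xi>)
      = \<i> ^ m * (LINT \<xi>|lborel. ?f s x \<xi>) + (- \<i>) ^ m * (LINT \<xi>|lborel. ?f (- s) (- x) \<xi>)" .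
    have "norm (LINT \<xi>|lborel. osc_symbol \<alpha> s 1 m x \<xi>)
      \<le> norm (LINT \<xi>|lborel. ?f s x \<xi>) + norm (LINT \<xi>|lborel. ?f (- s) (- x) \<xi>)"
      unfolding eq by (rule order_trans[OF norm_triangle_ineq]) (simp add: norm_mult norm_power)
    also have "\<dots> \<le> C * inverse (1 + x\<^sup>2) + C * inverse (1 + x\<^sup>2)"
    proof (rule add_mono)
      have "0 < 1 + x\<^sup>2" by (simp add: add_pos_nonneg)
      then show "norm (LINT \<xi>|lborel. ?f s x \<xi>) \<le> C * inverse (1 + x\<^sup>2)"
        "norm (LINT \<xi>|lborel. ?f (- s) (- x) \<xi>) \<le> C * inverse (1 + x\<^sup>2)"
        using C(2)[OF s, of x] C(2)[of "- s" "- x"] s by (simp_all only: divide_inverse[symmetric] pos_le_divide_eq) auto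
    qed
    finally have *: "norm (LINT \<xi>|lborel. osc_symbol \<alpha> s 1 m x \<xi>) \<le> 2 * (C * inverse (1 + x\<^sup>2))"
      by simp
    have "norm (osc_kernel \<alpha> s 1 m x) = norm (LINT \<xi>|lborel. osc_symbol \<alpha> s 1 m x \<xi>) / (2 * pi)"
      unfolding osc_kernel_def norm_mult norm_of_real by simp
    also have "\<dots> \<le> 2 * (C * inverse (1 + x\<^sup>2)) / (2 * pi)"
      using * by (intro divide_right_mono) auto
    \<comment> \<open>The two halves give 2C, and the prefactor 1/(2 pi) absorbs the 2 because pi
      \<ge> 1.\<close>
    also have "\<dots> \<le> C * inverse (1 + x\<^sup>2)"
    proof -
      have "0 \<le> C * inverse (1 + x\<^sup>2)"
        using C(1) by (intro mult_nonneg_nonneg) (auto intro: add_nonneg_nonneg)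
      moreover have "1 \<le> pi" using pi_ge_two by linarith
      ultimately have "(C * inverse (1 + x\<^sup>2)) * 1 \<le> (C * inverse (1 + x\<^sup>2)) * pi"
        by (intro mult_left_mono)
      then show ?thesis by (simp add: divide_le_eq)
    qed
    finally show ?thesis .
  qed
  show ?thesis by (rule that[OF C(1) bound])
qed

lemma osc_kernel_bounds:
  assumes "0 < \<alpha>" "\<alpha> < 2" "0 < m"
  obtains C where "0 \<le> C"
    "\<And>s t x. 1 \<le> t \<Longrightarrow> 0 \<le> s \<Longrightarrow> s \<le> t \<Longrightarrow> norm (osc_kernel \<alpha> s t m x) \<le> C * t powr (- (real m + 1) / \<alpha>)"
    "\<And>s t x. 1 \<le> t \<Longrightarrow> 0 \<le> s \<Longrightarrow> s \<le> t \<Longrightarrow>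
      (\<integral>\<^sup>+x. ennreal (norm (osc_kernel \<alpha> s t m x)) \<partial>lborel) \<le> ennreal (C * t powr (- real m / \<alpha>))"
proof -
  obtain C where C: "0 \<le> C"
    "\<And>s x. \<bar>s\<bar> \<le> 1 \<Longrightarrow> norm (osc_kernel \<alpha> s 1 m x) \<le> C * inverse (1 + x\<^sup>2)"
    using osc_kernel_unit_bound[OF assms(1,3)] by metis
  have pt: "norm (osc_kernel \<alpha> s t m x) \<le> C * t powr (- (real m + 1) / \<alpha>) * inverse (1 + (t powr (- 1 / \<alpha>) * x)\<^sup>2)"
    if t: "1 \<le> t" "0 \<le> s" "s \<le> t" for s t x
  proof -
    have "s * t powr (- 3 / \<alpha>) \<le> t * t powr (- 3 / \<alpha>)"
      using t by (intro mult_right_mono) auto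
    also have "\<dots> = t powr (1 - 3 / \<alpha>)"
      using t by (simp add: powr_diff powr_minus divide_inverse)
    \<comment> \<open>Since 3/\<alpha> > 1 the exponent is negative: the rescaled s lies in [0,1],
      where the unit bound is uniform.\<close>
    also have "\<dots> \<le> t powr 0"
      using t assms by (intro powr_mono) (auto simp: field_simps)
    finally have "\<bar>s * t powr (- 3 / \<alpha>)\<bar> \<le> 1" using t by (simp add: abs_mult)
    from mult_left_mono[OF C(2)[OF this, of "t powr (- 1 / \<alpha>) * x"], of "t powr (- (real m + 1) / \<alpha>)"]
    show ?thesis
      using t assms by (subst osc_kernel_scale) (auto simp: norm_mult mult_ac)
  qed
  show ?thesis
  \<comment> \<open>The factor pi is the integral of 1/(1+x^2), needed for the L^1 bound; as pi
    \<ge> 1 the same constant serves the sup bound.\<close>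
  proof (rule that[of "C * pi"])
    show "0 \<le> C * pi" using C by simp
    fix s t x :: real assume t: "1 \<le> t" "0 \<le> s" "s \<le> t"
    define c where "c = t powr (- 1 / \<alpha>)"
    have c: "0 < c" using t by (simp add: c_def)
    define A where "A = C * t powr (- (real m + 1) / \<alpha>)"
    have A: "0 \<le> A" using C by (simp add: A_def)
    have "norm (osc_kernel \<alpha> s t m x) \<le> A * inverse (1 + (t powr (- 1 / \<alpha>) * x)\<^sup>2)"
      using pt[OF t, of x] by (simp add: A_def)
    also have "\<dots> \<le> A * 1"
      using A by (intro mult_left_mono) (auto intro!: inverse_le_1_iff[THEN iffD2])
    also have "\<dots> \<le> A * pi"
      using A pi_ge_two by (intro mult_left_mono) auto
    finally show "norm (osc_kernel \<alpha> s t m x) \<le> C * pi * t powr (- (real m + 1) / \<alpha>)"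
      by (simp add: A_def mult_ac)
    have "(\<integral>\<^sup>+x. ennreal (norm (osc_kernel \<alpha> s t m x)) \<partial>lborel)
      \<le> (\<integral>\<^sup>+x. ennreal A * ennreal (inverse (1 + (0 + c * x)\<^sup>2)) \<partial>lborel)"
      using pt[OF t] A by (intro nn_integral_mono) (simp add: ennreal_mult[symmetric] A_def c_def)
    also have "\<dots> = ennreal A * (\<integral>\<^sup>+x. ennreal (inverse (1 + (0 + c * x)\<^sup>2)) \<partial>lborel)"
      by (rule nn_integral_cmult) measurable
    also have "(\<integral>\<^sup>+x. ennreal (inverse (1 + (0 + c * x)\<^sup>2)) \<partial>lborel) = ennreal (pi / c)"
    proof -
      have "ennreal pi = ennreal c * (\<integral>\<^sup>+x. ennreal (inverse (1 + (0 + c * x)\<^sup>2)) \<partial>lborel)"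
        using nn_integral_real_affine[of "\<lambda>x. ennreal (inverse (1 + x\<^sup>2))" c 0] c
        by (simp add: nn_integral_inverse_1_plus_square)
      then have "ennreal (1 / c) * ennreal pi = ennreal (1 / c) * (ennreal c * (\<integral>\<^sup>+x. ennreal (inverse (1 + (0 + c * x)\<^sup>2)) \<partial>lborel))"
        by simp
      then show ?thesis
        using c by (simp add: mult.assoc[symmetric] ennreal_mult[symmetric])
    qed
    also have "ennreal A * ennreal (pi / c) = ennreal (C * pi * t powr (- real m / \<alpha>))"
    proof -
      have "t powr (- (real m + 1) / \<alpha>) = t powr (- real m / \<alpha>) * c"
        unfolding c_def by (simp add: powr_add[symmetric] add_divide_distrib diff_divide_distrib)
      then show ?thesis
        using A c C by (simp add: ennreal_mult[symmetric] A_def)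
    qed
    finally show "(\<integral>\<^sup>+x. ennreal (norm (osc_kernel \<alpha> s t m x)) \<partial>lborel) \<le> ennreal (C * pi * t powr (- real m / \<alpha>))" .
  qed
qed

section \<open>Taylor expansion of the kernels\<close>

text \<open>The scaling law of r derivatives of the kernel in both end-point norms, with a common
  constant M. The predicate is stable under sums, multiples and translations, so the two norms need
  not be tracked separately. For later Tonelli and interpolation arguments it also records
  measurability.\<close>

definition decays :: "real \<Rightarrow> real \<Rightarrow> real \<Rightarrow> real \<Rightarrow> (real \<Rightarrow> complex) \<Rightarrow> bool" where
  "decays \<alpha> t r M f \<longleftrightarrow> f \<in> borel_measurable borel \<and> 0 \<le> M \<and>
     (\<forall>x. norm (f x) \<le> M * t powr (- (r + 1) / \<alpha>)) \<and>
     (\<integral>\<^sup>+x. ennreal (norm (f x)) \<partial>lborel) \<le> ennreal (M * t powr (- r / \<alpha>))"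

lemma decays_add:
  assumes "decays \<alpha> t r M f" "decays \<alpha> t r M' g"
  shows "decays \<alpha> t r (M + M') (\<lambda>x. f x + g x)"
  unfolding decays_def
proof (intro conjI allI)
  have [measurable]: "f \<in> borel_measurable borel" "g \<in> borel_measurable borel"
    using assms by (auto simp: decays_def)
  show "(\<lambda>x. f x + g x) \<in> borel_measurable borel" by measurable
  show "0 \<le> M + M'" using assms by (auto simp: decays_def)
  show "norm (f x + g x) \<le> (M + M') * t powr (- (r + 1) / \<alpha>)" for x
    using assms unfolding decays_def distrib_right by (intro norm_triangle_le add_mono) auto
  have "(\<integral>\<^sup>+x. ennreal (norm (f x + g x)) \<partial>lborel)
    \<le> (\<integral>\<^sup>+x. ennreal (norm (f x)) + ennreal (norm (g x)) \<partial>lborel)"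
    by (intro nn_integral_mono) (simp add: ennreal_plus[symmetric] norm_triangle_ineq del: ennreal_plus)
  also have "\<dots> = (\<integral>\<^sup>+x. ennreal (norm (f x)) \<partial>lborel) + (\<integral>\<^sup>+x. ennreal (norm (g x)) \<partial>lborel)"
    by (rule nn_integral_add) measurable
  also have "\<dots> \<le> ennreal (M * t powr (- r / \<alpha>)) + ennreal (M' * t powr (- r / \<alpha>))"
    using assms by (intro add_mono) (auto simp: decays_def)
  also have "\<dots> = ennreal ((M + M') * t powr (- r / \<alpha>))"
    using assms by (simp add: decays_def ennreal_plus[symmetric] distrib_right del: ennreal_plus)
  finally show "(\<integral>\<^sup>+x. ennreal (norm (f x + g x)) \<partial>lborel) \<le> ennreal ((M + M') * t powr (- r / \<alpha>))" .
qed

lemma decays_cmult: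
  assumes "decays \<alpha> t r M f"
  shows "decays \<alpha> t r (norm c * M) (\<lambda>x. c * f x)"
  unfolding decays_def
proof (intro conjI allI)
  have [measurable]: "f \<in> borel_measurable borel" and M: "0 \<le> M"
    using assms by (auto simp: decays_def)
  show "(\<lambda>x. c * f x) \<in> borel_measurable borel" by measurable
  show "0 \<le> norm c * M" using M by simp
  show "norm (c * f x) \<le> norm c * M * t powr (- (r + 1) / \<alpha>)" for x
    using assms unfolding decays_def norm_mult mult.assoc by (intro mult_left_mono) auto
  have "(\<integral>\<^sup>+x. ennreal (norm (c * f x)) \<partial>lborel) = ennreal (norm c) * (\<integral>\<^sup>+x. ennreal (norm (f x)) \<partial>lborel)"
    unfolding norm_mult ennreal_mult[OF norm_ge_zero norm_ge_zero] by (rule nn_integral_cmult) measurable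
  also have "\<dots> \<le> ennreal (norm c) * ennreal (M * t powr (- r / \<alpha>))"
    using assms by (intro mult_left_mono) (auto simp: decays_def)
  also have "\<dots> = ennreal (norm c * M * t powr (- r / \<alpha>))"
    using M by (simp add: ennreal_mult[symmetric] mult_ac)
  finally show "(\<integral>\<^sup>+x. ennreal (norm (c * f x)) \<partial>lborel) \<le> ennreal (norm c * M * t powr (- r / \<alpha>))" .
qed

lemma decays_sum:
  assumes "finite I" "\<And>i. i \<in> I \<Longrightarrow> decays \<alpha> t r (M i) (f i)"
  shows "decays \<alpha> t r (\<Sum>i\<in>I. M i) (\<lambda>x. \<Sum>i\<in>I. f i x)"
  using assms
proof (induction I rule: finite_induct)
  case empty
  then show ?case by (simp add: decays_def)
next
  case (insert i I)
  then show ?case by (auto intro!: decays_add)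
qed

lemma decays_shift:
  assumes "decays \<alpha> t r M f"
  shows "decays \<alpha> t r M (\<lambda>x. f (x - y))"
proof -
  have [measurable]: "f \<in> borel_measurable borel"
    using assms by (auto simp: decays_def)
  have "(\<integral>\<^sup>+x. ennreal (norm (f (x - y))) \<partial>lborel) = (\<integral>\<^sup>+x. ennreal (norm (f x)) \<partial>lborel)"
    using nn_integral_real_affine[of "\<lambda>x. ennreal (norm (f x))" 1 "- y"] by simp
  then show ?thesis
    using assms by (auto simp: decays_def)
qed

text \<open>The sup rate is the L^1 rate times t^(-1/\<alpha>), whatever r is, so comparing the L^1
  rates is enough.\<close>

lemma decays_mono:
  assumes "decays \<alpha> t r M f" "M * t powr (- r / \<alpha>) \<le> M' * t powr (- r' / \<alpha>)" "0 \<le> M'" "0 < t"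
  shows "decays \<alpha> t r' M' f"
proof -
  have sp: "t powr (- (q + 1) / \<alpha>) = t powr (- q / \<alpha>) * t powr (- 1 / \<alpha>)" for q
    by (simp add: powr_add[symmetric] add_divide_distrib diff_divide_distrib)
  have "M * t powr (- (r + 1) / \<alpha>) \<le> M' * t powr (- (r' + 1) / \<alpha>)"
    using mult_right_mono[OF assms(2), of "t powr (- 1 / \<alpha>)"] by (simp only: sp mult.assoc) simp
  then show ?thesis
    using assms unfolding decays_def by (auto intro: order_trans ennreal_leI)
qed

lemma decays_taylor:
  fixes h :: "real \<Rightarrow> nat \<Rightarrow> real \<Rightarrow> complex"
  assumes deriv: "\<And>x i \<theta>. (h x i has_vector_derivative h x (Suc i) \<theta>) (at \<theta>)"
    and p: "0 < p"
    and meas: "\<And>i. (\<lambda>z. h (fst z) i (snd z)) \<in> borel_measurable (lborel \<Otimes>\<^sub>M lborel)"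
    and decays: "\<And>\<theta>. \<theta> \<in> {0..1} \<Longrightarrow> decays \<alpha> t r M (\<lambda>x. h x p \<theta>)"
  shows "decays \<alpha> t r M (\<lambda>x. h x 0 1 - (\<Sum>i<p. h x i 0 /\<^sub>R fact i))"
  unfolding decays_def
proof (intro conjI allI)
  have [measurable]: "(\<lambda>x. h x i \<theta>) \<in> borel_measurable borel" for i \<theta>
    using measurable_compose[of "\<lambda>x. (x, \<theta>)" borel, OF _ meas[of i]] by simp
  show "(\<lambda>x. h x 0 1 - (\<Sum>i<p. h x i 0 /\<^sub>R fact i)) \<in> borel_measurable borel"
    by measurable
  show "0 \<le> M" using decays[of 0] by (auto simp: decays_def)
  show "norm (h x 0 1 - (\<Sum>i<p. h x i 0 /\<^sub>R fact i)) \<le> M * t powr (- (r + 1) / \<alpha>)" for x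
    using decays by (intro norm_taylor_remainder_le deriv p) (auto simp: decays_def)
  show "(\<integral>\<^sup>+x. ennreal (norm (h x 0 1 - (\<Sum>i<p. h x i 0 /\<^sub>R fact i))) \<partial>lborel) \<le> ennreal (M * t powr (- r / \<alpha>))"
    using decays meas[of p] by (intro nn_integral_taylor_remainder_le deriv p) (auto simp: decays_def case_prod_beta')
qed

lemma osc_kernel_decays:
  assumes "0 < \<alpha>" "\<alpha> < 2" "0 < m"
  obtains C where "\<And>s t. 1 \<le> t \<Longrightarrow> 0 \<le> s \<Longrightarrow> s \<le> t \<Longrightarrow> decays \<alpha> t m C (osc_kernel \<alpha> s t m)"
proof -
  obtain C where C: "0 \<le> C"
    "\<And>s t x. 1 \<le> t \<Longrightarrow> 0 \<le> s \<Longrightarrow> s \<le> t \<Longrightarrow> norm (osc_kernel \<alpha> s t m x) \<le> C * t powr (- (real m + 1) / \<alpha>)"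
    "\<And>s t x. 1 \<le> t \<Longrightarrow> 0 \<le> s \<Longrightarrow> s \<le> t \<Longrightarrow>
      (\<integral>\<^sup>+x. ennreal (norm (osc_kernel \<alpha> s t m x)) \<partial>lborel) \<le> ennreal (C * t powr (- real m / \<alpha>))"
    using osc_kernel_bounds[OF assms] by metis
  show ?thesis
    by (rule that[of C]) (use C in \<open>auto simp: decays_def\<close>)
qed

text \<open>Taylor expansion along the segment \<theta> \<mapsto> x - \<theta>y. Each order costs a
  factor |y| and gains one derivative; translating the kernel does not change its norms.\<close>

lemma decays_taylor_space:
  assumes "0 < \<alpha>" "\<alpha> < 2" "0 < p"
  obtains C where "0 \<le> C" "\<And>t y. 1 \<le> t \<Longrightarrow> decays \<alpha> t (real (m + p)) (\<bar>y\<bar> ^ p * C)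
    (\<lambda>x. osc_kernel \<alpha> 0 t m (x - y) - (\<Sum>i<p. complex_of_real ((- y) ^ i / fact i) * osc_kernel \<alpha> 0 t (m + i) x))"
proof -
  obtain C where C: "\<And>s t. 1 \<le> t \<Longrightarrow> 0 \<le> s \<Longrightarrow> s \<le> t \<Longrightarrow> decays \<alpha> t (m + p) C (osc_kernel \<alpha> s t (m + p))"
    using osc_kernel_decays[OF assms(1,2), of "m + p"] assms(3) by auto
  show ?thesis
  proof (rule that[of C])
    show "0 \<le> C" using C[of 1 0] by (auto simp: decays_def)
    fix t y :: real assume t: "1 \<le> t"
    define h where "h = (\<lambda>x i \<theta>. complex_of_real ((- y) ^ i) * osc_kernel \<alpha> 0 t (m + i) (x - \<theta> * y))"
    have "decays \<alpha> t (real (m + p)) (\<bar>y\<bar> ^ p * C) (\<lambda>x. h x 0 1 - (\<Sum>i<p. h x i 0 /\<^sub>R fact i))"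
    proof (rule decays_taylor[OF _ assms(3)])
      fix x i \<theta>
      have "((\<lambda>\<theta>. x - \<theta> * y) has_vector_derivative - y) (at \<theta>)"
        by (auto intro!: derivative_eq_intros)
      from has_vector_derivative_mult_right[OF vector_diff_chain_at[OF this osc_kernel_deriv_x], of \<alpha> t "complex_of_real ((- y) ^ i)"]
      show "(h x i has_vector_derivative h x (Suc i) \<theta>) (at \<theta>)"
        using t assms by (simp add: h_def o_def scaleR_conv_of_real mult_ac)
    next
      show "(\<lambda>z. h (fst z) i (snd z)) \<in> borel_measurable (lborel \<Otimes>\<^sub>M lborel)" for i
        unfolding h_def by measurable
      show "decays \<alpha> t (real (m + p)) (\<bar>y\<bar> ^ p * C) (\<lambda>x. h x p \<theta>)" for \<theta>
        using decays_cmult[OF decays_shift[OF C[OF t order_refl], of "\<theta> * y"], of "complex_of_real ((- y) ^ p)"] t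
        unfolding h_def norm_of_real by (simp add: power_abs)
    qed
    then show "decays \<alpha> t (real (m + p)) (\<bar>y\<bar> ^ p * C)
      (\<lambda>x. osc_kernel \<alpha> 0 t m (x - y) - (\<Sum>i<p. complex_of_real ((- y) ^ i / fact i) * osc_kernel \<alpha> 0 t (m + i) x))"
      by (simp add: h_def scaleR_conv_of_real divide_inverse mult_ac)
  qed
qed

text \<open>Taylor expansion along \<theta> \<mapsto> \<theta>t, which stays in the range 0 \<le> s
  \<le> t of the uniform bounds. Each order costs a factor t and gains three derivatives.\<close>

lemma decays_taylor_time:
  assumes "0 < \<alpha>" "\<alpha> < 2" "0 < p"
  obtains C where "0 \<le> C" "\<And>t. 1 \<le> t \<Longrightarrow> decays \<alpha> t (real (m + 3 * p)) (t ^ p * C)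
    (\<lambda>x. osc_kernel \<alpha> t t m x - (\<Sum>i<p. complex_of_real ((- t) ^ i / fact i) * osc_kernel \<alpha> 0 t (m + 3 * i) x))"
proof -
  obtain C where C: "\<And>s t. 1 \<le> t \<Longrightarrow> 0 \<le> s \<Longrightarrow> s \<le> t \<Longrightarrow> decays \<alpha> t (m + 3 * p) C (osc_kernel \<alpha> s t (m + 3 * p))"
    using osc_kernel_decays[OF assms(1,2), of "m + 3 * p"] assms(3) by auto
  show ?thesis
  proof (rule that[of C])
    show "0 \<le> C" using C[of 1 0] by (auto simp: decays_def)
    fix t :: real assume t: "1 \<le> t"
    define h where "h = (\<lambda>x i \<theta>. complex_of_real ((- t) ^ i) * osc_kernel \<alpha> (\<theta> * t) t (m + 3 * i) x)"
    have "decays \<alpha> t (real (m + 3 * p)) (t ^ p * C) (\<lambda>x. h x 0 1 - (\<Sum>i<p. h x i 0 /\<^sub>R fact i))"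
    proof (rule decays_taylor[OF _ assms(3)])
      fix x i \<theta>
      have "((\<lambda>\<theta>. \<theta> * t) has_vector_derivative t) (at \<theta>)"
        by (auto intro!: derivative_eq_intros)
      from has_vector_derivative_mult_right[OF vector_diff_chain_at[OF this osc_kernel_deriv_s[where m = "m + 3 * i"]],
          of \<alpha> t "complex_of_real ((- t) ^ i)" x]
      have "((\<lambda>\<theta>. complex_of_real ((- t) ^ i) * osc_kernel \<alpha> (\<theta> * t) t (m + 3 * i) x) has_vector_derivative
          complex_of_real ((- t) ^ Suc i) * osc_kernel \<alpha> (\<theta> * t) t (m + 3 * i + 3) x) (at \<theta>)"
        using t assms by (simp add: o_def scaleR_conv_of_real mult_ac)
      moreover have "m + 3 * Suc i = m + 3 * i + 3" by simp
      ultimately show "(h x i has_vector_derivative h x (Suc i) \<theta>) (at \<theta>)"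
        by (simp only: h_def)
    next
      show "(\<lambda>z. h (fst z) i (snd z)) \<in> borel_measurable (lborel \<Otimes>\<^sub>M lborel)" for i
        unfolding h_def by measurable
      show "decays \<alpha> t (real (m + 3 * p)) (t ^ p * C) (\<lambda>x. h x p \<theta>)" if "\<theta> \<in> {0..1}" for \<theta>
        using decays_cmult[OF C[OF t, of "\<theta> * t"], of "complex_of_real ((- t) ^ p)"] t that
        unfolding h_def norm_of_real by (simp add: power_abs mult_left_le_one_le)
    qed
    then show "decays \<alpha> t (real (m + 3 * p)) (t ^ p * C)
      (\<lambda>x. osc_kernel \<alpha> t t m x - (\<Sum>i<p. complex_of_real ((- t) ^ i / fact i) * osc_kernel \<alpha> 0 t (m + 3 * i) x))"
      by (simp add: h_def scaleR_conv_of_real divide_inverse mult_ac)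
  qed
qed

text \<open>The m-th derivative of the error for a unit mass at y: (-y)^n stands where (-1)^n times
  the n-th moment will stand after integration against the datum. The range l < N is empty for N =
  0, as is the sum over k.\<close>

definition kernel_remainder :: "real \<Rightarrow> nat \<Rightarrow> real \<Rightarrow> nat \<Rightarrow> real \<Rightarrow> real \<Rightarrow> complex" where
  "kernel_remainder \<alpha> N t m x y = osc_kernel \<alpha> t t m (x - y)
     - (\<Sum>n<Suc N. complex_of_real ((- y) ^ n / fact n) * osc_kernel \<alpha> 0 t (m + n) x)
     - (\<Sum>k = 1..N. complex_of_real ((- t) ^ k / fact k) *
         (\<Sum>l<N. complex_of_real ((- y) ^ l / fact l) * osc_kernel \<alpha> 0 t (m + 3 * k + l) x))"

text \<open>Since \<alpha> < 2 gives t \<le> t^(2/\<alpha>), a factor t is paid for by two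
  derivatives. Of the three gained with each factor t, one is left over.\<close>

lemma power_mult_powr_le:
  assumes "0 < \<alpha>" "\<alpha> < 2" "1 \<le> t" "2 * real k \<le> a - b"
  shows "t ^ k * t powr (- a / \<alpha>) \<le> t powr (- b / \<alpha>)"
proof -
  have "real k * \<alpha> \<le> real k * 2"
    using assms by (intro mult_left_mono) auto
  then have "real k \<le> (a - b) / \<alpha>"
    using assms by (simp add: pos_le_divide_eq)
  then have "real k + - a / \<alpha> \<le> - b / \<alpha>"
    by (simp add: diff_divide_distrib)
  then have "t powr (real k + - a / \<alpha>) \<le> t powr (- b / \<alpha>)"
    using assms by (intro powr_mono) auto
  then show ?thesis
    using assms powr_realpow[of t k] unfolding powr_add by simp
qed

text \<open>The remainder is the sum of a time remainder of order N + 1 at x - y, a space remainder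
  of order N + 1 for the term k = 0, and space remainders of order N for 1 \<le> k \<le> N. All
  decay at least as fast as m + N + 1 derivatives.\<close>

lemma kernel_remainder_decays:
  assumes \<alpha>: "0 < \<alpha>" "\<alpha> < 2"
  obtains C where "0 \<le> C"
    "\<And>t y. 1 \<le> t \<Longrightarrow> decays \<alpha> t (real (m + N + 1)) (C * (1 + \<bar>y\<bar>) ^ (N + 1)) (\<lambda>x. kernel_remainder \<alpha> N t m x y)"
proof -
  let ?K = "osc_kernel \<alpha>"
  let ?A = "\<lambda>t x. ?K t t m x - (\<Sum>i<Suc N. complex_of_real ((- t) ^ i / fact i) * ?K 0 t (m + 3 * i) x)"
  let ?B = "\<lambda>p m t y x. ?K 0 t m (x - y) - (\<Sum>i<p. complex_of_real ((- y) ^ i / fact i) * ?K 0 t (m + i) x)"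
  obtain A where A: "0 \<le> A" "\<And>t. 1 \<le> t \<Longrightarrow> decays \<alpha> t (real (m + 3 * Suc N)) (t ^ Suc N * A) (?A t)"
    by (rule decays_taylor_time[OF \<alpha> zero_less_Suc[of N], where m = m]) (rule that)
  obtain B where B: "0 \<le> B" "\<And>t y. 1 \<le> t \<Longrightarrow> decays \<alpha> t (real (m + Suc N)) (\<bar>y\<bar> ^ Suc N * B) (?B (Suc N) m t y)"
    by (rule decays_taylor_space[OF \<alpha> zero_less_Suc[of N], where m = m]) (rule that)
  \<comment> \<open>The guard 0 < N is there because the space expansion needs positive order; for N
    = 0 there are no indices k to treat.\<close>
  have "\<forall>k. \<exists>C. 0 \<le> C \<and> (0 < N \<longrightarrow> (\<forall>t y. 1 \<le> t \<longrightarrow>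
      decays \<alpha> t (real (m + 3 * k + N)) (\<bar>y\<bar> ^ N * C) (?B N (m + 3 * k) t y)))"
  proof
    fix k
    show "\<exists>C. 0 \<le> C \<and> (0 < N \<longrightarrow> (\<forall>t y. 1 \<le> t \<longrightarrow>
      decays \<alpha> t (real (m + 3 * k + N)) (\<bar>y\<bar> ^ N * C) (?B N (m + 3 * k) t y)))"
    proof (cases "0 < N")
      case True
      obtain C where "0 \<le> C" "\<And>t y. 1 \<le> t \<Longrightarrow> decays \<alpha> t (real (m + 3 * k + N)) (\<bar>y\<bar> ^ N * C) (?B N (m + 3 * k) t y)"
        by (rule decays_taylor_space[OF \<alpha> True, where m = "m + 3 * k"]) (rule that)
      then show ?thesis by blast
    qed auto
  qed
  from choice[OF this] obtain D where D': "\<forall>k. 0 \<le> D k \<and> (0 < N \<longrightarrow> (\<forall>t y. 1 \<le> t \<longrightarrow>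
      decays \<alpha> t (real (m + 3 * k + N)) (\<bar>y\<bar> ^ N * D k) (?B N (m + 3 * k) t y)))" ..
  have D: "0 \<le> D k"
    "0 < N \<Longrightarrow> 1 \<le> t \<Longrightarrow> decays \<alpha> t (real (m + 3 * k + N)) (\<bar>y\<bar> ^ N * D k) (?B N (m + 3 * k) t y)" for k t y
    using D' by (blast, blast)
  define C where "C = A + B + (\<Sum>k = 1..N. D k)"
  show ?thesis
  proof (rule that[of C])
    show "0 \<le> C" using A(1) B(1) D(1) by (auto simp: C_def intro!: add_nonneg_nonneg sum_nonneg)
    fix t y :: real assume t: "1 \<le> t"
    let ?w = "(1 + \<bar>y\<bar>) ^ (N + 1)"
    have w1: "1 \<le> ?w" by (rule one_le_power) simp
    have wS: "\<bar>y\<bar> ^ Suc N \<le> ?w" unfolding Suc_eq_plus1 by (rule power_mono) auto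
    have wN: "\<bar>y\<bar> ^ N \<le> ?w"
    proof -
      have "\<bar>y\<bar> ^ N \<le> (1 + \<bar>y\<bar>) ^ N" by (rule power_mono) auto
      also have "\<dots> \<le> ?w" by (rule power_increasing) auto
      finally show ?thesis .
    qed
    have dA: "decays \<alpha> t (real (m + N + 1)) (A * ?w) (\<lambda>x. ?A t (x - y))"
    proof (rule decays_mono[OF decays_shift[OF A(2)[OF t]]])
      \<comment> \<open>The budget is met exactly: 3(N+1) - (N+1) = 2(N+1).\<close>
      have "t ^ Suc N * t powr (- real (m + 3 * Suc N) / \<alpha>) \<le> t powr (- real (m + N + 1) / \<alpha>)"
        using \<alpha> t by (rule power_mult_powr_le) simp
      also have "\<dots> \<le> ?w * t powr (- real (m + N + 1) / \<alpha>)"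
        using mult_right_mono[OF w1 powr_ge_zero] by (simp only: mult_1)
      finally have "A * (t ^ Suc N * t powr (- real (m + 3 * Suc N) / \<alpha>)) \<le> A * (?w * t powr (- real (m + N + 1) / \<alpha>))"
        by (rule mult_left_mono) (rule A(1))
      then show "t ^ Suc N * A * t powr (- real (m + 3 * Suc N) / \<alpha>) \<le> A * ?w * t powr (- real (m + N + 1) / \<alpha>)"
        by (simp only: mult_ac)
    qed (use A(1) t in auto)
    have dB: "decays \<alpha> t (real (m + N + 1)) (B * ?w) (?B (Suc N) m t y)"
    proof (rule decays_mono[OF B(2)[OF t]])
      show "\<bar>y\<bar> ^ Suc N * B * t powr (- real (m + Suc N) / \<alpha>) \<le> B * ?w * t powr (- real (m + N + 1) / \<alpha>)"
        using mult_right_mono[OF mult_left_mono[OF wS B(1)], of "t powr (- real (m + Suc N) / \<alpha>)"]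
        by (simp add: mult_ac)
    qed (use B(1) t in auto)
    have dD: "decays \<alpha> t (real (m + N + 1)) (D k * ?w) (\<lambda>x. complex_of_real ((- t) ^ k / fact k) * ?B N (m + 3 * k) t y x)"
      if k: "k \<in> {1..N}" for k
    proof (rule decays_mono[OF decays_cmult[OF D(2)[OF _ t]]])
      show "0 < N" using k by simp
      have n: "norm (complex_of_real ((- t) ^ k / fact k)) \<le> t ^ k"
      proof -
        have "t ^ k / fact k \<le> t ^ k / 1"
          using t fact_ge_1[of k, where 'a=real] by (intro divide_left_mono) auto
        then show ?thesis
          using t by (simp only: norm_of_real abs_divide power_abs abs_minus_cancel) simp
      qed
      have "norm (complex_of_real ((- t) ^ k / fact k)) * (\<bar>y\<bar> ^ N * D k) * t powr (- real (m + 3 * k + N) / \<alpha>)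
        \<le> t ^ k * (?w * D k) * t powr (- real (m + 3 * k + N) / \<alpha>)"
        using n wN D(1)[of k] t by (intro mult_right_mono mult_mono) auto
      also have "\<dots> = D k * ?w * (t ^ k * t powr (- real (m + 3 * k + N) / \<alpha>))"
        by (simp only: mult_ac)
      \<comment> \<open>The condition is 3k + N - (N+1) \<ge> 2k, that is k \<ge> 1.\<close>
      also have "\<dots> \<le> D k * ?w * t powr (- real (m + N + 1) / \<alpha>)"
        using D(1)[of k] k by (intro mult_left_mono power_mult_powr_le \<alpha> t) auto
      finally show "norm (complex_of_real ((- t) ^ k / fact k)) * (\<bar>y\<bar> ^ N * D k) * t powr (- real (m + 3 * k + N) / \<alpha>)
        \<le> D k * ?w * t powr (- real (m + N + 1) / \<alpha>)" .
    qed (use D(1) t in auto)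
    have "decays \<alpha> t (real (m + N + 1)) (A * ?w + B * ?w + (\<Sum>k = 1..N. D k * ?w))
      (\<lambda>x. ?A t (x - y) + ?B (Suc N) m t y x + (\<Sum>k = 1..N. complex_of_real ((- t) ^ k / fact k) * ?B N (m + 3 * k) t y x))"
      by (intro decays_add decays_sum dA dB dD) auto
    moreover have "A * ?w + B * ?w + (\<Sum>k = 1..N. D k * ?w) = C * ?w"
      by (simp only: C_def distrib_right sum_distrib_right)
    moreover have "?A t (x - y) + ?B (Suc N) m t y x + (\<Sum>k = 1..N. complex_of_real ((- t) ^ k / fact k) * ?B N (m + 3 * k) t y x)
      = kernel_remainder \<alpha> N t m x y" for x
    proof -
      \<comment> \<open>The term i = 0 cancels against the leading term of
        \<open>?B (Suc N) m\<close>, each term i = k against that of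
        \<open>?B N (m + 3 * k)\<close>.\<close>
      have "(\<Sum>i<Suc N. complex_of_real ((- t) ^ i / fact i) * ?K 0 t (m + 3 * i) (x - y))
        = ?K 0 t m (x - y) + (\<Sum>k = 1..N. complex_of_real ((- t) ^ k / fact k) * ?K 0 t (m + 3 * k) (x - y))"
      proof -
        have "{..<Suc N} = insert 0 {1..N}" by auto
        then show ?thesis by (simp only:) simp
      qed
      then show ?thesis
        unfolding kernel_remainder_def right_diff_distrib sum_subtractf by simp
    qed
    ultimately show "decays \<alpha> t (real (m + N + 1)) (C * ?w) (\<lambda>x. kernel_remainder \<alpha> N t m x y)"
      by simp
  qed
qed

section \<open>Convolution with the datum, and the derivatives of the error\<close>

text \<open>No rate in t is recorded, but m = 0 is included. This is what makes the convolution
  converge and dominates its derivative.\<close>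

lemma osc_kernel_bounded:
  assumes "0 < \<alpha>" "0 < t"
  obtains B where "\<And>s x. norm (osc_kernel \<alpha> s t m x) \<le> B"
proof -
  let ?I = "LINT \<xi>|lborel. \<bar>\<xi>\<bar> ^ m * exp (- (t * \<bar>\<xi>\<bar> powr \<alpha>))"
  have "norm (osc_kernel \<alpha> s t m x) \<le> norm (complex_of_real (1 / (2 * pi))) * ?I" for s x
    unfolding osc_kernel_def norm_mult
    using assms integrable_osc_symbol[OF assms, of s m x] integrable_abs_power_mult_exp[OF assms, of m]
    by (intro mult_left_mono Bochner_Integration.integral_norm_bound_integral) (auto simp: norm_osc_symbol)
  then show ?thesis by (rule that)
qed

lemma integrable_osc_kernel_mult:
  assumes "0 < \<alpha>" "0 < t" "integrable lborel u"
  shows "integrable lborel (\<lambda>y. osc_kernel \<alpha> s t m (x - y) * complex_of_real (u y))"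
proof -
  obtain B where B: "\<And>s x. norm (osc_kernel \<alpha> s t m x) \<le> B"
    using osc_kernel_bounded[OF assms(1,2)] by metis
  have [measurable]: "u \<in> borel_measurable lborel" using assms(3) by auto
  show ?thesis
  proof (rule Bochner_Integration.integrable_bound)
    show "integrable lborel (\<lambda>y. B * \<bar>u y\<bar>)"
      using assms(3) by (intro integrable_mult_right integrable_abs)
    show "(\<lambda>y. osc_kernel \<alpha> s t m (x - y) * complex_of_real (u y)) \<in> borel_measurable lborel"
      by measurable
    have b: "norm (osc_kernel \<alpha> s t m (x - y) * complex_of_real (u y)) \<le> B * \<bar>u y\<bar>" for y
      unfolding norm_mult norm_of_real using B by (intro mult_right_mono) auto
    show "AE y in lborel. norm (osc_kernel \<alpha> s t m (x - y) * complex_of_real (u y)) \<le> norm (B * \<bar>u y\<bar>)"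
      unfolding real_norm_def by (intro AE_I2 order_trans[OF b abs_ge_self])
  qed
qed

lemma conv_osc_kernel_deriv:
  assumes "0 < \<alpha>" "0 < t" "integrable lborel u"
  shows "(conv (osc_kernel \<alpha> s t m) u has_vector_derivative conv (osc_kernel \<alpha> s t (Suc m)) u x) (at x)"
proof -
  obtain B where B: "\<And>s x. norm (osc_kernel \<alpha> s t (Suc m) x) \<le> B"
    using osc_kernel_bounded[OF assms(1,2)] by metis
  have [measurable]: "u \<in> borel_measurable lborel" using assms(3) by auto
  show ?thesis
    unfolding conv_def[abs_def]
  proof (rule integral_has_vector_derivative_dominated)
    show "integrable lborel (\<lambda>y. osc_kernel \<alpha> s t m (x - y) * complex_of_real (u y))" for x
      by (rule integrable_osc_kernel_mult[OF assms])
    show "integrable lborel (\<lambda>y. B * \<bar>u y\<bar>)"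
      using assms(3) by (intro integrable_mult_right integrable_abs)
    show "(\<lambda>y. osc_kernel \<alpha> s t (Suc m) (x - y) * complex_of_real (u y)) \<in> borel_measurable lborel" for x
      by measurable
    show "norm (osc_kernel \<alpha> s t (Suc m) (x - y) * complex_of_real (u y)) \<le> B * \<bar>u y\<bar>" for x y
      unfolding norm_mult norm_of_real using B by (intro mult_right_mono) auto
    fix x y :: real
    have "((\<lambda>x. x - y) has_vector_derivative 1) (at x)"
      by (auto intro!: derivative_eq_intros)
    from vector_diff_chain_at[OF this osc_kernel_deriv_x[OF assms(1,2)]]
    have "((\<lambda>x. osc_kernel \<alpha> s t m (x - y)) has_vector_derivative osc_kernel \<alpha> s t (Suc m) (x - y)) (at x)"
      by (simp add: o_def)
    then show "((\<lambda>x. osc_kernel \<alpha> s t m (x - y) * complex_of_real (u y)) has_vector_derivative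
        osc_kernel \<alpha> s t (Suc m) (x - y) * complex_of_real (u y)) (at x)"
      by (rule has_vector_derivative_mult_left)
  qed
qed

text \<open>For m = 0 this is the function of the theorem, with all derivatives of G written as
  kernels; (-1)^k is the sign of (-1)^(3k). Raising m differentiates in x.\<close>

definition asymptotic_error :: "real \<Rightarrow> nat \<Rightarrow> (real \<Rightarrow> real) \<Rightarrow> real \<Rightarrow> nat \<Rightarrow> real \<Rightarrow> complex" where
  "asymptotic_error \<alpha> N u t m x = conv (osc_kernel \<alpha> t t m) u x
     - (\<Sum>n = 0..N. complex_of_real ((-1) ^ n / fact n * moment n u) * osc_kernel \<alpha> 0 t (m + n) x)
     - (\<Sum>k = 1..N. complex_of_real (t ^ k / fact k) *
         (\<Sum>l = 0..N - 1. complex_of_real ((-1) ^ l / fact l * moment l u) *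
            ((-1) ^ k * osc_kernel \<alpha> 0 t (m + 3 * k + l) x)))"

lemma asymptotic_error_deriv:
  assumes "0 < \<alpha>" "0 < t" "integrable lborel u"
  shows "(asymptotic_error \<alpha> N u t m has_vector_derivative asymptotic_error \<alpha> N u t (Suc m) x) (at x)"
  unfolding asymptotic_error_def[abs_def] add_Suc
  by (intro has_vector_derivative_diff has_vector_derivative_sum has_vector_derivative_mult_right
      conv_osc_kernel_deriv osc_kernel_deriv_x assms)

lemma dx_eqI: "(\<And>x. (f has_vector_derivative g x) (at x)) \<Longrightarrow> dx f = g"
  by (rule ext) (simp add: dx_def vector_derivative_at)

lemma funpow_dx_asymptotic_error:
  assumes "0 < \<alpha>" "0 < t" "integrable lborel u"
  shows "(dx ^^ j) (asymptotic_error \<alpha> N u t 0) = asymptotic_error \<alpha> N u t j"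
  by (induction j) (auto intro!: dx_eqI asymptotic_error_deriv assms)

lemma funpow_dx_osc_kernel:
  assumes "0 < \<alpha>" "0 < t"
  shows "(dx ^^ n) (\<lambda>x. c * osc_kernel \<alpha> s t m x) = (\<lambda>x. c * osc_kernel \<alpha> s t (m + n) x)"
  by (induction n) (auto intro!: dx_eqI has_vector_derivative_mult_right osc_kernel_deriv_x assms)

lemma funpow_neg_dx_osc_kernel:
  assumes "0 < \<alpha>" "0 < t"
  shows "(neg_dx ^^ n) (osc_kernel \<alpha> s t m) = (\<lambda>x. (-1) ^ n * osc_kernel \<alpha> s t (m + n) x)"
proof (induction n)
  case (Suc n)
  have "dx (\<lambda>x. (-1) ^ n * osc_kernel \<alpha> s t (m + n) x) = (\<lambda>x. (-1) ^ n * osc_kernel \<alpha> s t (Suc (m + n)) x)"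
    by (intro dx_eqI has_vector_derivative_mult_right osc_kernel_deriv_x assms)
  with Suc show ?case by (simp add: neg_dx_def[abs_def])
qed simp

text \<open>Integrating the remainder in y against u turns the powers of -y into signed moments and
  the kernel into the convolution. Value and integrability are obtained together because the norm
  estimates use both.\<close>

lemma has_bochner_integral_asymptotic_error:
  assumes \<alpha>: "0 < \<alpha>" "0 < t"
    and u: "integrable lborel u"
    and moments: "\<And>n. n \<le> N \<Longrightarrow> integrable lborel (\<lambda>y. u y * y ^ n)"
  shows "has_bochner_integral lborel (\<lambda>y. kernel_remainder \<alpha> N t m x y * complex_of_real (u y))
    (asymptotic_error \<alpha> N u t m x)"
proof -
  have mom: "has_bochner_integral lborel (\<lambda>y. complex_of_real ((- y) ^ n / fact n) * c * complex_of_real (u y))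
     (complex_of_real ((-1) ^ n / fact n * moment n u) * c)" if "n \<le> N" for n c
  proof -
    have "has_bochner_integral lborel (\<lambda>y. u y * y ^ n) (moment n u)"
      unfolding moment_def using moments[OF that] by (rule has_bochner_integral_integrable)
    then have "has_bochner_integral lborel (\<lambda>y. complex_of_real (u y * y ^ n)) (complex_of_real (moment n u))"
      by (rule has_bochner_integral_of_real)
    then have I: "has_bochner_integral lborel (\<lambda>y. complex_of_real ((-1) ^ n / fact n) * c * complex_of_real (u y * y ^ n))
      (complex_of_real ((-1) ^ n / fact n) * c * complex_of_real (moment n u))"
      by (rule has_bochner_integral_mult_right)
    have 1: "complex_of_real ((- y) ^ n / fact n) * c * complex_of_real (u y)
      = complex_of_real ((-1) ^ n / fact n) * c * complex_of_real (u y * y ^ n)" for y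
      by (subst power_minus) simp
    have 2: "complex_of_real ((-1) ^ n / fact n * moment n u) * c
      = complex_of_real ((-1) ^ n / fact n) * c * complex_of_real (moment n u)"
      by simp
    show ?thesis unfolding 1 2 by (rule I)
  qed
  have 1: "has_bochner_integral lborel (\<lambda>y. osc_kernel \<alpha> t t m (x - y) * complex_of_real (u y)) (conv (osc_kernel \<alpha> t t m) u x)"
    unfolding conv_def by (intro has_bochner_integral_integrable integrable_osc_kernel_mult assms)
  have 2: "has_bochner_integral lborel
     (\<lambda>y. \<Sum>n = 0..N. complex_of_real ((- y) ^ n / fact n) * osc_kernel \<alpha> 0 t (m + n) x * complex_of_real (u y))
     (\<Sum>n = 0..N. complex_of_real ((-1) ^ n / fact n * moment n u) * osc_kernel \<alpha> 0 t (m + n) x)"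
    by (intro has_bochner_integral_sum mom) auto
  have 3: "has_bochner_integral lborel
     (\<lambda>y. \<Sum>k = 1..N. complex_of_real (t ^ k / fact k) * (\<Sum>l = 0..N - 1.
        complex_of_real ((- y) ^ l / fact l) * ((-1) ^ k * osc_kernel \<alpha> 0 t (m + 3 * k + l) x) * complex_of_real (u y)))
     (\<Sum>k = 1..N. complex_of_real (t ^ k / fact k) *
         (\<Sum>l = 0..N - 1. complex_of_real ((-1) ^ l / fact l * moment l u) *
            ((-1) ^ k * osc_kernel \<alpha> 0 t (m + 3 * k + l) x)))"
    by (intro has_bochner_integral_sum has_bochner_integral_mult_right mom) auto
  have eq: "kernel_remainder \<alpha> N t m x y * complex_of_real (u y) = osc_kernel \<alpha> t t m (x - y) * complex_of_real (u y)
    - (\<Sum>n = 0..N. complex_of_real ((- y) ^ n / fact n) * osc_kernel \<alpha> 0 t (m + n) x * complex_of_real (u y))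
    - (\<Sum>k = 1..N. complex_of_real (t ^ k / fact k) * (\<Sum>l = 0..N - 1.
        complex_of_real ((- y) ^ l / fact l) * ((-1) ^ k * osc_kernel \<alpha> 0 t (m + 3 * k + l) x) * complex_of_real (u y)))" for y
  proof -
    have i1: "{..<Suc N} = {0..N}" by auto
    have i2: "complex_of_real ((- t) ^ k / fact k) *
         (\<Sum>l<N. complex_of_real ((- y) ^ l / fact l) * osc_kernel \<alpha> 0 t (m + 3 * k + l) x) * complex_of_real (u y)
       = complex_of_real (t ^ k / fact k) * (\<Sum>l = 0..N - 1.
        complex_of_real ((- y) ^ l / fact l) * ((-1) ^ k * osc_kernel \<alpha> 0 t (m + 3 * k + l) x) * complex_of_real (u y))"
      if "k \<in> {1..N}" for k
    proof -
      \<comment> \<open>An index k in {1..N} forces N \<ge> 1, so the subtraction is not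
        truncated.\<close>
      have "{0..N - 1} = {..<N}" using that by auto
      moreover have "complex_of_real ((- t) ^ k / fact k) = complex_of_real (t ^ k / fact k) * (-1) ^ k"
        by (subst power_minus) simp
      ultimately show ?thesis
        by (simp add: sum_distrib_left sum_distrib_right mult_ac)
    qed
    show ?thesis
      unfolding kernel_remainder_def left_diff_distrib i1 sum_distrib_right
      using i2 by (simp add: sum_distrib_right)
  qed
  show ?thesis
    unfolding eq asymptotic_error_def
    by (intro has_bochner_integral_diff 1 2 3)
qed

section \<open>The asymptotic expansion\<close>

text \<open>The decay of \<open>kernel_remainder\<close> is integrated against |u0|, whose weighted
  integrability absorbs the growth in y, and the sup and L^1 bounds are interpolated. For N = 0 the
  truncated N - 1 is harmless, as the sum over k is empty.\<close>

theorem theorem1: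
  fixes \<alpha> :: real and p :: ereal and j N :: nat and u0 :: "real \<Rightarrow> real"
  assumes "0 < \<alpha>" and "\<alpha> < 2"
    and "1 \<le> p"
    and "u0 \<in> borel_measurable lborel"
    and "integrable lborel (\<lambda>x. (1 + \<bar>x\<bar>) ^ (N + 1) * \<bar>u0 x\<bar>)"
  shows "\<exists>c::real. \<forall>t::real. t \<ge> 1 \<longrightarrow>
    Hdot_norm p j (\<lambda>x.
        conv (S_kernel \<alpha> t) u0 x
      - (\<Sum>n = 0..N. complex_of_real ((-1) ^ n / fact n * moment n u0) * (dx ^^ n) (G_kernel \<alpha> t) x)
      - (\<Sum>k = 1..N. complex_of_real (t ^ k / fact k) *
           (\<Sum>l = 0..N - 1. complex_of_real ((-1) ^ l / fact l * moment l u0) *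
               (dx ^^ l) ((neg_dx ^^ (3 * k)) (G_kernel \<alpha> t)) x)))
    \<le> ennreal (c * t powr (- (1 - inv_exp p) / \<alpha> - real j / \<alpha> - real (N + 1) / \<alpha>))"
proof -
  let ?w = "\<lambda>y. (1 + \<bar>y\<bar>) ^ (N + 1) * \<bar>u0 y\<bar>"
  have [measurable]: "u0 \<in> borel_measurable borel" using assms(4) by simp
  have moments: "integrable lborel (\<lambda>y. u0 y * y ^ n)" if "n \<le> N" for n
  proof (rule Bochner_Integration.integrable_bound[OF assms(5)])
    have "norm (u0 y * y ^ n) \<le> norm (?w y)" for y
    proof -
      have "\<bar>y\<bar> ^ n \<le> (1 + \<bar>y\<bar>) ^ n" by (rule power_mono) auto
      also have "\<dots> \<le> (1 + \<bar>y\<bar>) ^ (N + 1)" using that by (intro power_increasing) auto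
      finally have "\<bar>y\<bar> ^ n * \<bar>u0 y\<bar> \<le> ?w y" by (rule mult_right_mono) simp
      then show ?thesis by (simp add: abs_mult power_abs mult.commute)
    qed
    then show "AE y in lborel. norm (u0 y * y ^ n) \<le> norm (?w y)" by simp
  qed measurable
  have u0: "integrable lborel u0" using moments[of 0] by simp
  obtain C where C: "0 \<le> C" "\<And>t y. 1 \<le> t \<Longrightarrow>
      decays \<alpha> t (real (j + N + 1)) (C * (1 + \<bar>y\<bar>) ^ (N + 1)) (\<lambda>x. kernel_remainder \<alpha> N t j x y)"
    by (rule kernel_remainder_decays[OF assms(1,2), where m = j and N = N]) (rule that)
  define U where "U = (LINT y|lborel. ?w y)"
  have U: "0 \<le> U" unfolding U_def by (rule Bochner_Integration.integral_nonneg_AE) simp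
  \<comment> \<open>The summand 1 makes c positive even if u0 vanishes, so that both interpolation
    bounds are positive.\<close>
  define c where "c = C * U + 1"
  have c: "0 < c" using C(1) U by (simp add: c_def add_nonneg_pos)
  show ?thesis
  proof (intro exI[of _ c] allI impI)
    fix t :: real assume t: "1 \<le> t"
    then have t0: "0 < t" by simp
    let ?E = "asymptotic_error \<alpha> N u0 t"
    let ?R = "kernel_remainder \<alpha> N t j"
    define r where "r = real (j + N + 1)"
    define A where "A = c * t powr (- (r + 1) / \<alpha>)"
    define B where "B = c * t powr (- r / \<alpha>)"
    have rep: "has_bochner_integral lborel (\<lambda>y. ?R x y * complex_of_real (u0 y)) (?E j x)" for x
      using assms(1) t0 u0 moments by (rule has_bochner_integral_asymptotic_error)
    have E: "?E j x = (LINT y|lborel. ?R x y * complex_of_real (u0 y))"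
      "integrable lborel (\<lambda>y. ?R x y * complex_of_real (u0 y))" for x
      using rep[of x] by (auto simp: has_bochner_integral_iff)
    have [measurable]: "(\<lambda>z. ?R (f z) (g z)) \<in> borel_measurable M"
      if [measurable]: "f \<in> borel_measurable M" "g \<in> borel_measurable M" for f g and M :: "'z measure"
      unfolding kernel_remainder_def by measurable
    have sup: "norm (?E j x) \<le> A" for x
    proof -
      have "norm (?E j x) \<le> (LINT y|lborel. C * t powr (- (r + 1) / \<alpha>) * ?w y)"
        unfolding E(1)
      proof (rule Bochner_Integration.integral_norm_bound_integral[OF E(2)])
        show "integrable lborel (\<lambda>y. C * t powr (- (r + 1) / \<alpha>) * ?w y)"
          using assms(5) by (rule integrable_mult_right)
        fix y :: real
        have "norm (?R x y) \<le> C * (1 + \<bar>y\<bar>) ^ (N + 1) * t powr (- (r + 1) / \<alpha>)"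
          using C(2)[OF t] unfolding decays_def r_def by blast
        then have "norm (?R x y) * \<bar>u0 y\<bar> \<le> C * (1 + \<bar>y\<bar>) ^ (N + 1) * t powr (- (r + 1) / \<alpha>) * \<bar>u0 y\<bar>"
          by (rule mult_right_mono) simp
        then show "norm (?R x y * complex_of_real (u0 y)) \<le> C * t powr (- (r + 1) / \<alpha>) * ?w y"
          by (simp only: norm_mult norm_of_real mult_ac)
      qed
      also have "\<dots> = C * U * t powr (- (r + 1) / \<alpha>)"
        by (simp add: U_def)
      also have "\<dots> \<le> A"
        unfolding A_def c_def by (intro mult_right_mono) auto
      finally show ?thesis .
    qed
    have L1: "(\<integral>\<^sup>+x. ennreal (norm (?E j x)) \<partial>lborel) \<le> ennreal B"
    proof -
      \<comment> \<open>Minkowski's inequality in L^1: after the exchange of integrals, the bound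
        for fixed y applies.\<close>
      have "(\<integral>\<^sup>+x. ennreal (norm (?E j x)) \<partial>lborel)
        \<le> (\<integral>\<^sup>+x. \<integral>\<^sup>+y. ennreal (norm (?R x y * complex_of_real (u0 y))) \<partial>lborel \<partial>lborel)"
        unfolding E(1) by (intro nn_integral_mono integral_norm_bound_ennreal E(2))
      also have "\<dots> = (\<integral>\<^sup>+y. \<integral>\<^sup>+x. ennreal (norm (?R x y * complex_of_real (u0 y))) \<partial>lborel \<partial>lborel)"
        by (rule lborel_pair.Fubini'[symmetric]) measurable
      also have "\<dots> \<le> (\<integral>\<^sup>+y. ennreal (C * t powr (- r / \<alpha>) * ?w y) \<partial>lborel)"
      proof (rule nn_integral_mono)
        fix y :: real
        have "(\<integral>\<^sup>+x. ennreal (norm (?R x y * complex_of_real (u0 y))) \<partial>lborel)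
          = (\<integral>\<^sup>+x. ennreal \<bar>u0 y\<bar> * ennreal (norm (?R x y)) \<partial>lborel)"
          by (simp add: norm_mult ennreal_mult mult.commute)
        also have "\<dots> = ennreal \<bar>u0 y\<bar> * (\<integral>\<^sup>+x. ennreal (norm (?R x y)) \<partial>lborel)"
          by (rule nn_integral_cmult) measurable
        also have "\<dots> \<le> ennreal \<bar>u0 y\<bar> * ennreal (C * (1 + \<bar>y\<bar>) ^ (N + 1) * t powr (- r / \<alpha>))"
          using C(2)[OF t, of y] unfolding decays_def r_def by (intro mult_left_mono) auto
        also have "\<dots> = ennreal (\<bar>u0 y\<bar> * (C * (1 + \<bar>y\<bar>) ^ (N + 1) * t powr (- r / \<alpha>)))"
          using C(1) by (intro ennreal_mult[symmetric]) auto
        finally show "(\<integral>\<^sup>+x. ennreal (norm (?R x y * complex_of_real (u0 y))) \<partial>lborel)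
          \<le> ennreal (C * t powr (- r / \<alpha>) * ?w y)"
          by (simp only: mult_ac)
      qed
      also have "\<dots> = ennreal (LINT y|lborel. C * t powr (- r / \<alpha>) * ?w y)"
        using C(1) by (intro nn_integral_eq_integral integrable_mult_right assms(5)) auto
      also have "(LINT y|lborel. C * t powr (- r / \<alpha>) * ?w y) = C * U * t powr (- r / \<alpha>)"
        by (simp add: U_def)
      also have "ennreal \<dots> \<le> ennreal B"
        unfolding B_def c_def by (intro ennreal_leI mult_right_mono) auto
      finally show ?thesis .
    qed
    have "?E j \<in> borel_measurable lborel"
      unfolding E(1)[abs_def] by measurable
    then have Lp: "Lp_norm p (?E j) \<le> ennreal (A powr (1 - inv_exp p) * B powr inv_exp p)"
      using c t0 by (intro Lp_norm_le_interpolation assms(3) sup L1) (auto simp: A_def B_def)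
    have pow: "(c * t powr x) powr q = c powr q * t powr (x * q)" for x q
      using c t0 by (simp add: powr_mult powr_powr)
    have "A powr (1 - inv_exp p) * B powr inv_exp p
      = c powr (1 - inv_exp p + inv_exp p) * t powr (- (r + 1) / \<alpha> * (1 - inv_exp p) + - r / \<alpha> * inv_exp p)"
      unfolding A_def B_def pow powr_add by (simp only: mult_ac)
    \<comment> \<open>The weighted mean of r + 1 and r is r + 1 - 1/p, with r = j + N + 1.\<close>
    also have "- (r + 1) / \<alpha> * (1 - inv_exp p) + - r / \<alpha> * inv_exp p
      = - (1 - inv_exp p) / \<alpha> - real j / \<alpha> - real (N + 1) / \<alpha>"
      using assms(1) by (simp add: r_def field_simps)
    finally have AB: "A powr (1 - inv_exp p) * B powr inv_exp p
      = c * t powr (- (1 - inv_exp p) / \<alpha> - real j / \<alpha> - real (N + 1) / \<alpha>)"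
      using c by simp
    have "(dx ^^ n) (osc_kernel \<alpha> 0 t 0) = osc_kernel \<alpha> 0 t n" for n
      using funpow_dx_osc_kernel[OF assms(1) t0, of n 1 0 0] by simp
    moreover have "(dx ^^ l) ((neg_dx ^^ (3 * k)) (osc_kernel \<alpha> 0 t 0)) x = (-1) ^ k * osc_kernel \<alpha> 0 t (3 * k + l) x" for k l x
      unfolding funpow_neg_dx_osc_kernel[OF assms(1) t0] funpow_dx_osc_kernel[OF assms(1) t0]
      by (simp add: power_mult)
    ultimately have fun_eq: "(\<lambda>x. conv (S_kernel \<alpha> t) u0 x
      - (\<Sum>n = 0..N. complex_of_real ((-1) ^ n / fact n * moment n u0) * (dx ^^ n) (G_kernel \<alpha> t) x)
      - (\<Sum>k = 1..N. complex_of_real (t ^ k / fact k) *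
           (\<Sum>l = 0..N - 1. complex_of_real ((-1) ^ l / fact l * moment l u0) *
               (dx ^^ l) ((neg_dx ^^ (3 * k)) (G_kernel \<alpha> t)) x))) = ?E 0"
      by (intro ext) (simp only: S_kernel_eq_osc_kernel G_kernel_eq_osc_kernel asymptotic_error_def add_0)
    show "Hdot_norm p j (\<lambda>x. conv (S_kernel \<alpha> t) u0 x
      - (\<Sum>n = 0..N. complex_of_real ((-1) ^ n / fact n * moment n u0) * (dx ^^ n) (G_kernel \<alpha> t) x)
      - (\<Sum>k = 1..N. complex_of_real (t ^ k / fact k) *
           (\<Sum>l = 0..N - 1. complex_of_real ((-1) ^ l / fact l * moment l u0) *
               (dx ^^ l) ((neg_dx ^^ (3 * k)) (G_kernel \<alpha> t)) x)))
      \<le> ennreal (c * t powr (- (1 - inv_exp p) / \<alpha> - real j / \<alpha> - real (N + 1) / \<alpha>))"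
      using Lp unfolding Hdot_norm_def fun_eq funpow_dx_asymptotic_error[OF assms(1) t0 u0] AB .
  qed
qed

end
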